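(* Let $G_0=Sp(\infty,q)$, $q\leqq\infty$. The domain $D_0$ of all $(0,F^{(1)},V_{\mathbb H})\in\mathfrak X_{\mathcal F,L}$ with $F^{(1)}$ a maximal $h$-negative definite ($\mathbb H$-)subspace of $V_{\mathbb H}$ is realized as the bounded domain of all finitary $\mathbb H$-linear maps $X:(V_{\mathbb H})_-\to(V_{\mathbb H})_+$ such that $I-X^*X$ is positive definite, where $(0,F^{(1)},V_{\mathbb H})$ corresponds to the map $X$ given by $\pi_-(x)\mapsto\pi_+(x)$ for $x\in F^{(1)}$; and there the action of $G_0$ is $$\begin{pmatrix}A&B\\C&D\end{pmatrix}:X\mapsto(AX+B)(CX+D)^{-1}.$$
   Context: $V_{\mathbb H}=\mathbb H^{\infty,q}$ is the quaternionic vector space with countable $\mathbb H$-basis $L=\{\dots,v_{-2},v_{-1};v_1,\dots,v_q\}$ if $q<\infty$, $L=\{\dots,v_{-2},v_{-1};v_1,v_2,\dots\}$ if $q=\infty$, with $\mathbb H$-hermitian form $h(v_i,v_j)=\delta_{i,j}$ for $i<0$, $h(v_i,v_j)=-\delta_{i,j}$ for $i>0$. $(V_{\mathbb H})_+=\mathrm{Span}_{\mathbb H}\{v_i\mid i<0\}$, $(V_{\mathbb H})_-=\mathrm{Span}_{\mathbb H}\{v_i\mid i>0\}$, with $h$-orthogonal projections $\pi_\pm:V_{\mathbb H}\to(V_{\mathbb H})_\pm$. $G=SL(\infty+q;\mathbb H)$ is the quaternionic special linear group of $\mathbb H$-linear transformations of $V_{\mathbb H}$ fixing all but finitely many elements of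 $L$ (direct limit of the $SL(n;\mathbb H)$); $G_0=Sp(\infty,q)$ is the subgroup preserving $h$. Elements of $G_0$ are written in block form relative to $V_{\mathbb H}=(V_{\mathbb H})_+\oplus(V_{\mathbb H})_-$ (matrices acting on the left on columns, scalars on the right). With $\mathcal F=(0,(V_{\mathbb H})_-,V_{\mathbb H})$, $\mathfrak X_{\mathcal F,L}=G(\mathcal F)$ is the quaternionic flag (Grassmann) manifold. A linear map $X$ is finitary if its matrix relative to $L$ has only finitely many nonzero entries; $X^*$ is the quaternionic conjugate transpose. *)

theory Defs
  imports "HOL-Analysis.Analysis" "HOL-Library.Poly_Mapping" "HOL-Combinatorics.Permutations"
begin

section \<open>Quaternions\<close>

datatype quat = Quat (qre: real) (qi: real) (qj: real) (qk: real)

lemma quat_eq_iff: "x = y \<longleftrightarrow> qre x = qre y \<and> qi x = qi y \<and> qj x = qj y \<and> qk x = qk y"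
  by (cases x; cases y) auto

instantiation quat :: real_vector
begin

definition "0 = Quat 0 0 0 0"
definition "x + y = Quat (qre x + qre y) (qi x + qi y) (qj x + qj y) (qk x + qk y)"
definition "- x = Quat (- qre x) (- qi x) (- qj x) (- qk x)"
definition "x - y = Quat (qre x - qre y) (qi x - qi y) (qj x - qj y) (qk x - qk y)"
definition "scaleR r x = Quat (r * qre x) (r * qi x) (r * qj x) (r * qk x)"

instance
  by standard
    (auto simp: quat_eq_iff zero_quat_def plus_quat_def uminus_quat_def minus_quat_def
      scaleR_quat_def algebra_simps)

end

definition qcnj :: "quat \<Rightarrow> quat"
  where "qcnj x = Quat (qre x) (- qi x) (- qj x) (- qk x)"

definition qnorm2 :: "quat \<Rightarrow> real"
  where "qnorm2 x = (qre x)\<^sup>2 + (qi x)\<^sup>2 + (qj x)\<^sup>2 + (qk x)\<^sup>2"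

instantiation quat :: real_algebra_1
begin

definition "1 = Quat 1 0 0 0"
definition "x * y = Quat
  (qre x * qre y - qi x * qi y - qj x * qj y - qk x * qk y)
  (qre x * qi y + qi x * qre y + qj x * qk y - qk x * qj y)
  (qre x * qj y - qi x * qk y + qj x * qre y + qk x * qi y)
  (qre x * qk y + qi x * qj y - qj x * qi y + qk x * qre y)"

instance
  by standard
    (auto simp: quat_eq_iff zero_quat_def plus_quat_def scaleR_quat_def one_quat_def
      times_quat_def algebra_simps)

end

lemma qnorm2_nonneg: "0 \<le> qnorm2 x"
  by (simp add: qnorm2_def)

lemma qnorm2_eq_0_iff: "qnorm2 x = 0 \<longleftrightarrow> x = 0"
proof
  assume h: "qnorm2 x = 0"
  have "0 \<le> (qre x)\<^sup>2" "0 \<le> (qi x)\<^sup>2" "0 \<le> (qj x)\<^sup>2" "0 \<le> (qk x)\<^sup>2"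
    by simp_all
  with h have "(qre x)\<^sup>2 = 0" "(qi x)\<^sup>2 = 0" "(qj x)\<^sup>2 = 0" "(qk x)\<^sup>2 = 0"
    unfolding qnorm2_def by linarith+
  then show "x = 0" by (simp add: quat_eq_iff zero_quat_def)
qed (simp add: qnorm2_def zero_quat_def)

lemma qnorm2_mult: "qnorm2 (x * y) = qnorm2 x * qnorm2 y"
  by (simp add: qnorm2_def times_quat_def power2_eq_square algebra_simps)

lemma qcnj_mult_self: "qcnj x * x = qnorm2 x *\<^sub>R 1" "x * qcnj x = qnorm2 x *\<^sub>R 1"
  by (simp_all add: quat_eq_iff qcnj_def times_quat_def scaleR_quat_def one_quat_def
      qnorm2_def power2_eq_square algebra_simps)

instantiation quat :: real_div_algebra
begin

definition "inverse x = inverse (qnorm2 x) *\<^sub>R qcnj x" for x :: quat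
definition "x div y = x * inverse y" for x y :: quat

instance
proof
  fix x :: quat
  assume "x \<noteq> 0"
  then have "qnorm2 x \<noteq> 0" by (simp add: qnorm2_eq_0_iff)
  then show "inverse x * x = 1" "x * inverse x = 1"
    by (simp_all add: inverse_quat_def qcnj_mult_self)
next
  show "inverse (0::quat) = 0"
    by (simp add: inverse_quat_def quat_eq_iff zero_quat_def scaleR_quat_def qnorm2_def)
qed (simp add: divide_quat_def)

end

instantiation quat :: real_normed_div_algebra
begin

definition "norm x = sqrt (qnorm2 x)"
definition "sgn x = x /\<^sub>R norm x" for x :: quat
definition "dist x y = norm (x - y)" for x y :: quat
definition [code del]:
  "uniformity = (INF e\<in>{0<..}. principal {(x :: quat, y). dist x y < e})"
definition [code del]:
  "open (U :: quat set) \<longleftrightarrow> (\<forall>x\<in>U. eventually (\<lambda>(x', y). x' = x \<longrightarrow> y \<in> U) uniformity)"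

instance
proof
  fix x y :: quat and r :: real
  show "norm x = 0 \<longleftrightarrow> x = 0"
    by (simp add: norm_quat_def qnorm2_eq_0_iff)
  show "norm (x * y) = norm x * norm y"
    by (simp add: norm_quat_def qnorm2_mult real_sqrt_mult)
  have "qnorm2 (r *\<^sub>R x) = r\<^sup>2 * qnorm2 x"
    by (simp add: qnorm2_def scaleR_quat_def power_mult_distrib algebra_simps)
  then show "norm (r *\<^sub>R x) = \<bar>r\<bar> * norm x"
    by (simp add: norm_quat_def real_sqrt_mult)
  have nn: "norm q = norm ((qre q, qi q), (qj q, qk q))" for q :: quat
    by (simp add: norm_quat_def qnorm2_def norm_prod_def)
  show "norm (x + y) \<le> norm x + norm y"
    unfolding nn
    using norm_triangle_ineq[of "((qre x, qi x), (qj x, qk x))" "((qre y, qi y), (qj y, qk y))"]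
    by (simp add: plus_quat_def)
qed (fact sgn_quat_def dist_quat_def uniformity_quat_def open_quat_def)+

end

section \<open>Quaternionic vector spaces with scalars on the right\<close>

class right_hspace = ab_group_add +
  fixes rscale :: "'a \<Rightarrow> quat \<Rightarrow> 'a"  (infixl "*\<^sub>H" 75)
  assumes rscale_add_left: "(x + y) *\<^sub>H a = x *\<^sub>H a + y *\<^sub>H a"
    and rscale_add_right: "x *\<^sub>H (a + b) = x *\<^sub>H a + x *\<^sub>H b"
    and rscale_rscale: "x *\<^sub>H a *\<^sub>H b = x *\<^sub>H (a * b)"
    and rscale_one: "x *\<^sub>H 1 = x"
begin

lemma rscale_zero_left: "0 *\<^sub>H a = 0"
  using rscale_add_left[of 0 0 a] by simp

end

instantiation quat :: right_hspace
begin

definition rscale_quat :: "quat \<Rightarrow> quat \<Rightarrow> quat" where "rscale_quat = (*)"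

instance
  by standard (simp_all add: rscale_quat_def distrib_left distrib_right mult.assoc)

end

instantiation poly_mapping :: (type, right_hspace) right_hspace
begin

definition rscale_poly_mapping :: "('a \<Rightarrow>\<^sub>0 'b) \<Rightarrow> quat \<Rightarrow> 'a \<Rightarrow>\<^sub>0 'b"
  where "rscale_poly_mapping x a = Poly_Mapping.map (\<lambda>c. c *\<^sub>H a) x"

lemma lookup_rscale: "Poly_Mapping.lookup (x *\<^sub>H a) i = Poly_Mapping.lookup x i *\<^sub>H a"
  by (simp add: rscale_poly_mapping_def map.rep_eq when_def rscale_zero_left)

instance
  by standard
    (rule poly_mapping_eqI, simp add: lookup_rscale lookup_add rscale_add_left rscale_add_right
      rscale_rscale rscale_one)+

end

instantiation prod :: (right_hspace, right_hspace) right_hspace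
begin

definition rscale_prod :: "'a \<times> 'b \<Rightarrow> quat \<Rightarrow> 'a \<times> 'b"
  where "rscale_prod x a = (fst x *\<^sub>H a, snd x *\<^sub>H a)"

instance
  by standard
    (simp_all add: rscale_prod_def prod_eq_iff rscale_add_left rscale_add_right
      rscale_rscale rscale_one)

end

definition hsubspace :: "'a::right_hspace set \<Rightarrow> bool"
  where "hsubspace E \<longleftrightarrow>
    0 \<in> E \<and> (\<forall>x\<in>E. \<forall>y\<in>E. x + y \<in> E) \<and> (\<forall>x\<in>E. \<forall>a. x *\<^sub>H a \<in> E)"

definition hlinear :: "('a::right_hspace \<Rightarrow> 'b::right_hspace) \<Rightarrow> bool"
  where "hlinear f \<longleftrightarrow>
    (\<forall>x y. f (x + y) = f x + f y) \<and> (\<forall>x a. f (x *\<^sub>H a) = f x *\<^sub>H a)"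

section \<open>Finitary linear maps and their matrices\<close>

definition entry :: "(('j \<Rightarrow>\<^sub>0 quat) \<Rightarrow> ('i \<Rightarrow>\<^sub>0 quat)) \<Rightarrow> 'i \<Rightarrow> 'j \<Rightarrow> quat"
  where "entry X i j = Poly_Mapping.lookup (X (Poly_Mapping.single j 1)) i"

definition finitary :: "(('j \<Rightarrow>\<^sub>0 quat) \<Rightarrow> ('i \<Rightarrow>\<^sub>0 quat)) \<Rightarrow> bool"
  where "finitary X \<longleftrightarrow> hlinear X \<and> finite {(i, j). entry X i j \<noteq> 0}"

text \<open>The linear map with matrix \<open>M\<close>; the columns of \<open>M\<close> are assumed to be finite.\<close>

definition map_of_matrix :: "('i \<Rightarrow> 'j \<Rightarrow> quat) \<Rightarrow> ('j \<Rightarrow>\<^sub>0 quat) \<Rightarrow> ('i \<Rightarrow>\<^sub>0 quat)"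
  where "map_of_matrix M x =
    (\<Sum>j\<in>Poly_Mapping.keys x. \<Sum>i | M i j \<noteq> 0.
      Poly_Mapping.single i (M i j * Poly_Mapping.lookup x j))"

definition conj_transpose ::
    "(('j \<Rightarrow>\<^sub>0 quat) \<Rightarrow> ('i \<Rightarrow>\<^sub>0 quat)) \<Rightarrow> ('i \<Rightarrow>\<^sub>0 quat) \<Rightarrow> ('j \<Rightarrow>\<^sub>0 quat)"
  where "conj_transpose X = map_of_matrix (\<lambda>j i. qcnj (entry X i j))"

definition herm :: "('i \<Rightarrow>\<^sub>0 quat) \<Rightarrow> ('i \<Rightarrow>\<^sub>0 quat) \<Rightarrow> quat"
  where "herm x y =
    (\<Sum>i\<in>Poly_Mapping.keys x. qcnj (Poly_Mapping.lookup x i) * Poly_Mapping.lookup y i)"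

definition hnorm :: "('i \<Rightarrow>\<^sub>0 quat) \<Rightarrow> real"
  where "hnorm x = sqrt (qre (herm x x))"

text \<open>For a self-adjoint \<open>T\<close> the quaternion \<open>herm x (T x)\<close> is real.\<close>

definition pos_def :: "(('i \<Rightarrow>\<^sub>0 quat) \<Rightarrow> ('i \<Rightarrow>\<^sub>0 quat)) \<Rightarrow> bool"
  where "pos_def T \<longleftrightarrow>
    (\<forall>x y. herm (T x) y = herm x (T y)) \<and> (\<forall>x. x \<noteq> 0 \<longrightarrow> 0 < qre (herm x (T x)))"

section \<open>Direct limit and quotient topologies\<close>

text \<open>The family \<open>\<A>\<close> is meant to be directed under inclusion of subspaces.\<close>

definition direct_limit_topology :: "'a topology set \<Rightarrow> 'a topology"
  where "direct_limit_topology \<A> = topology (\<lambda>U.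
    U \<subseteq> \<Union>(topspace ` \<A>) \<and> (\<forall>T\<in>\<A>. openin T (U \<inter> topspace T)))"

lemma openin_direct_limit_topology:
  "openin (direct_limit_topology \<A>) U \<longleftrightarrow>
    U \<subseteq> \<Union>(topspace ` \<A>) \<and> (\<forall>T\<in>\<A>. openin T (U \<inter> topspace T))"
proof -
  have "istopology (\<lambda>U. U \<subseteq> \<Union>(topspace ` \<A>) \<and> (\<forall>T\<in>\<A>. openin T (U \<inter> topspace T)))"
    (is "istopology ?P")
    unfolding istopology_def
  proof (intro conjI[of "\<forall>S T. ?P S \<longrightarrow> ?P T \<longrightarrow> ?P (S \<inter> T)"] allI impI)
    fix S R
    assume S: "?P S" and R: "?P R"
    have "openin T (S \<inter> R \<inter> topspace T)" if "T \<in> \<A>" for T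
    proof -
      have "openin T ((S \<inter> topspace T) \<inter> (R \<inter> topspace T))"
        by (rule openin_Int) (use S R that in simp_all)
      then show ?thesis by (simp add: Int_ac)
    qed
    with S show "?P (S \<inter> R)" by (metis Int_lower1 subset_trans)
  next
    fix \<K>
    assume K: "\<forall>K\<in>\<K>. ?P K"
    have "openin T (\<Union>\<K> \<inter> topspace T)" if "T \<in> \<A>" for T
    proof -
      have "openin T (\<Union>((\<lambda>K. K \<inter> topspace T) ` \<K>))"
        using K that by (intro openin_Union) auto
      then show ?thesis by simp
    qed
    moreover have "\<Union>\<K> \<subseteq> \<Union>(topspace ` \<A>)"
      using K by (meson Union_least)
    ultimately show "?P (\<Union>\<K>)" by simp
  qed
  then show ?thesis by (simp add: direct_limit_topology_def)
qed

definition image_quotient_topology :: "'a topology \<Rightarrow> ('a \<Rightarrow> 'b) \<Rightarrow> 'b topology"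
  where "image_quotient_topology T f = topology (\<lambda>U.
    U \<subseteq> f ` topspace T \<and> openin T {x \<in> topspace T. f x \<in> U})"

lemma openin_image_quotient_topology:
  "openin (image_quotient_topology T f) U \<longleftrightarrow>
    U \<subseteq> f ` topspace T \<and> openin T {x \<in> topspace T. f x \<in> U}"
proof -
  have "istopology (\<lambda>U. U \<subseteq> f ` topspace T \<and> openin T {x \<in> topspace T. f x \<in> U})"
    (is "istopology ?P")
    unfolding istopology_def
  proof (intro conjI[of "\<forall>S R. ?P S \<longrightarrow> ?P R \<longrightarrow> ?P (S \<inter> R)"] allI impI)
    fix S R
    assume S: "?P S" and R: "?P R"
    have "{x \<in> topspace T. f x \<in> S \<inter> R}
        = {x \<in> topspace T. f x \<in> S} \<inter> {x \<in> topspace T. f x \<in> R}" by auto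
    with S R show "?P (S \<inter> R)" by (simp add: openin_Int le_infI1)
  next
    fix \<K>
    assume K: "\<forall>K\<in>\<K>. ?P K"
    have "{x \<in> topspace T. f x \<in> \<Union>\<K>} = \<Union>((\<lambda>K. {x \<in> topspace T. f x \<in> K}) ` \<K>)" by auto
    moreover have "openin T (\<Union>((\<lambda>K. {x \<in> topspace T. f x \<in> K}) ` \<K>))"
      using K by (intro openin_Union) auto
    moreover have "\<Union>\<K> \<subseteq> f ` topspace T"
      using K by (meson Union_least)
    ultimately show "?P (\<Union>\<K>)" by simp
  qed
  then show ?thesis by (simp add: image_quotient_topology_def)
qed

text \<open>Finitary maps carry the direct limit topology of the finite-dimensional spaces of
  \<open>S \<times> T\<close> matrices.\<close>

definition finitary_block :: "'i set \<Rightarrow> 'j set \<Rightarrow> (('j \<Rightarrow>\<^sub>0 quat) \<Rightarrow> ('i \<Rightarrow>\<^sub>0 quat)) set"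
  where "finitary_block S T =
    {X. hlinear X \<and> (\<forall>i j. entry X i j \<noteq> 0 \<longrightarrow> i \<in> S \<and> j \<in> T)}"

definition finitary_topology :: "(('j \<Rightarrow>\<^sub>0 quat) \<Rightarrow> ('i \<Rightarrow>\<^sub>0 quat)) topology"
  where "finitary_topology = direct_limit_topology
    {pullback_topology (finitary_block S T) (\<lambda>X (i, j). entry X i j) euclidean | S T.
      finite S \<and> finite T}"

section \<open>The space, its hermitian form, and the flag manifold\<close>

text \<open>The space is written as the direct sum of its positive and negative parts. The basis
  vector \<open>v\<^sub>-\<^sub>n\<^sub>-\<^sub>1\<close> is indexed by \<open>Inl n\<close> with \<open>n :: nat\<close>, and \<open>v\<^sub>1, v\<^sub>2, \<dots>\<close> are indexed by
  \<open>Inr j\<close> with \<open>j :: 'q\<close>, where \<open>'q\<close> is a countable type; \<open>q\<close> is its cardinality,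
  possibly infinite.\<close>

type_synonym hplus = "nat \<Rightarrow>\<^sub>0 quat"
type_synonym 'q hminus = "'q \<Rightarrow>\<^sub>0 quat"
type_synonym 'q hspace = "hplus \<times> 'q hminus"

fun vbasis :: "nat + 'q \<Rightarrow> 'q hspace" where
  "vbasis (Inl n) = (Poly_Mapping.single n 1, 0)"
| "vbasis (Inr j) = (0, Poly_Mapping.single j 1)"

fun coord :: "'q hspace \<Rightarrow> nat + 'q \<Rightarrow> quat" where
  "coord x (Inl n) = Poly_Mapping.lookup (fst x) n"
| "coord x (Inr j) = Poly_Mapping.lookup (snd x) j"

abbreviation proj_plus :: "'q hspace \<Rightarrow> hplus" where "proj_plus \<equiv> fst"
abbreviation proj_minus :: "'q hspace \<Rightarrow> 'q hminus" where "proj_minus \<equiv> snd"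

definition hform :: "'q hspace \<Rightarrow> 'q hspace \<Rightarrow> quat"
  where "hform x y = herm (proj_plus x) (proj_plus y) - herm (proj_minus x) (proj_minus y)"

lemma herm_single:
  "herm (Poly_Mapping.single i 1) (Poly_Mapping.single j 1) = (if i = j then 1 else 0)"
  by (simp add: herm_def lookup_single when_def qcnj_def one_quat_def zero_quat_def quat_eq_iff
      times_quat_def)

lemma herm_zero: "herm 0 x = 0" "herm x 0 = 0"
  by (simp_all add: herm_def)

lemma hform_vbasis:
  "hform (vbasis a) (vbasis b) = (if a \<noteq> b then 0 else if isl a then 1 else - 1)"
  by (cases a; cases b) (simp_all add: hform_def herm_single herm_zero)

text \<open>Writing \<open>\<H> = \<C> \<oplus> j\<C>\<close>, left multiplication by \<open>a = u + j v\<close> (with \<open>u, v\<close> complex) is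
  right \<open>\<C>\<close>-linear and has the matrix with rows \<open>(u, - cnj v)\<close> and \<open>(v, cnj u)\<close>.\<close>

fun complexify :: "quat \<Rightarrow> bool \<Rightarrow> bool \<Rightarrow> complex" where
  "complexify a False False = Complex (qre a) (qi a)"
| "complexify a False True = - cnj (Complex (qj a) (- qk a))"
| "complexify a True False = Complex (qj a) (- qk a)"
| "complexify a True True = cnj (Complex (qre a) (qi a))"

lemma complexify_mult:
  "complexify (a * b) s t =
    complexify a s False * complexify b False t + complexify a s True * complexify b True t"
  by (cases s; cases t)
    (simp_all add: times_quat_def complex_eq_iff algebra_simps)

text \<open>The determinant of the complex matrix of size \<open>2 * card S\<close> that represents an
  \<open>S \<times> S\<close> quaternionic matrix. The library determinants need an index type
  or a numbering of \<open>S\<close>, hence the explicit expansion over permutations.\<close>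

definition complex_det :: "'k set \<Rightarrow> ('k \<Rightarrow> 'k \<Rightarrow> quat) \<Rightarrow> complex"
  where "complex_det S M =
    (\<Sum>p | p permutes (S \<times> (UNIV :: bool set)). of_int (sign p) *
      (\<Prod>(k, s) \<in> S \<times> UNIV. complexify (M k (fst (p (k, s)))) s (snd (p (k, s)))))"

definition gentry :: "('q hspace \<Rightarrow> 'q hspace) \<Rightarrow> nat + 'q \<Rightarrow> nat + 'q \<Rightarrow> quat"
  where "gentry g k l = coord (g (vbasis l)) k"

text \<open>The copy of \<open>SL(card S; \<H>)\<close> acting on the span of the basis vectors in \<open>S\<close>. Any linear
  map that fixes all but finitely many basis vectors is supported on some finite \<open>S\<close>.\<close>

definition SL_block :: "(nat + 'q) set \<Rightarrow> ('q hspace \<Rightarrow> 'q hspace) set"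
  where "SL_block S = {g. hlinear g \<and> bij g \<and> (\<forall>l. l \<notin> S \<longrightarrow> g (vbasis l) = vbasis l) \<and>
    (\<forall>l\<in>S. \<forall>k. k \<notin> S \<longrightarrow> gentry g k l = 0) \<and> complex_det S (gentry g) = 1}"

definition SL_inf :: "('q hspace \<Rightarrow> 'q hspace) set"
  where "SL_inf = (\<Union>S \<in> {S. finite S}. SL_block S)"

definition SL_inf_topology :: "('q hspace \<Rightarrow> 'q hspace) topology"
  where "SL_inf_topology = direct_limit_topology
    {pullback_topology (SL_block S) (\<lambda>g (k, l). gentry g k l) euclidean | S. finite S}"

definition Sp_inf :: "('q hspace \<Rightarrow> 'q hspace) set"
  where "Sp_inf = {g \<in> SL_inf. \<forall>x y. hform (g x) (g y) = hform x y}"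

type_synonym 'q hflag = "'q hspace set \<times> 'q hspace set \<times> 'q hspace set"

definition flag_act :: "('q hspace \<Rightarrow> 'q hspace) \<Rightarrow> 'q hflag \<Rightarrow> 'q hflag"
  where "flag_act g = (\<lambda>(E0, E1, E2). (g ` E0, g ` E1, g ` E2))"

definition base_flag :: "'q hflag"
  where "base_flag = ({0}, {x. proj_plus x = 0}, UNIV)"

definition flag_manifold :: "'q hflag set"
  where "flag_manifold = (\<lambda>g. flag_act g base_flag) ` SL_inf"

definition flag_topology :: "'q hflag topology"
  where "flag_topology = image_quotient_topology SL_inf_topology (\<lambda>g. flag_act g base_flag)"

section \<open>The domain, its matrix realization, and block forms\<close>

text \<open>The quaternion \<open>hform x x\<close> is always real.\<close>

definition neg_definite :: "'q hspace set \<Rightarrow> bool"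
  where "neg_definite E \<longleftrightarrow> (\<forall>x\<in>E. x \<noteq> 0 \<longrightarrow> qre (hform x x) < 0)"

definition max_neg_definite :: "'q hspace set \<Rightarrow> bool"
  where "max_neg_definite E \<longleftrightarrow> hsubspace E \<and> neg_definite E \<and>
    (\<forall>E'. hsubspace E' \<and> neg_definite E' \<and> E \<subseteq> E' \<longrightarrow> E' = E)"

definition flag_domain :: "'q hflag set"
  where "flag_domain = {(E0, E1, E2) \<in> flag_manifold. max_neg_definite E1}"

definition matrix_domain :: "('q hminus \<Rightarrow> hplus) set"
  where "matrix_domain = {X. finitary X \<and> pos_def (\<lambda>y. y - conj_transpose X (X y))}"

text \<open>This is the map \<open>proj_minus x \<mapsto> proj_plus x\<close> for \<open>x\<close> in the middle subspace of the flag; it is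
  meaningful when \<open>proj_minus\<close> maps that subspace bijectively onto \<open>'q hminus\<close>.\<close>

definition graph_map :: "'q hflag \<Rightarrow> 'q hminus \<Rightarrow> hplus"
  where "graph_map = (\<lambda>(E0, E1, E2) y. THE z. \<exists>x\<in>E1. proj_minus x = y \<and> proj_plus x = z)"

definition block_A :: "('q hspace \<Rightarrow> 'q hspace) \<Rightarrow> hplus \<Rightarrow> hplus"
  where "block_A g x = proj_plus (g (x, 0))"

definition block_B :: "('q hspace \<Rightarrow> 'q hspace) \<Rightarrow> 'q hminus \<Rightarrow> hplus"
  where "block_B g y = proj_plus (g (0, y))"

definition block_C :: "('q hspace \<Rightarrow> 'q hspace) \<Rightarrow> hplus \<Rightarrow> 'q hminus"
  where "block_C g x = proj_minus (g (x, 0))"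

definition block_D :: "('q hspace \<Rightarrow> 'q hspace) \<Rightarrow> 'q hminus \<Rightarrow> 'q hminus"
  where "block_D g y = proj_minus (g (0, y))"

end

theory Submission
  imports Defs
begin

text \<open>
  A negative definite subspace \<open>E = g V\<^sub>-\<close> meets \<open>V\<^sub>+\<close> trivially, and \<open>g\<close> is the identity outside a
  finite block, so \<open>E\<close> projects isomorphically onto \<open>V\<^sub>-\<close> and is the graph of a finitary strict
  contraction \<open>X\<close>. Conversely the graph of \<open>X\<close> is the image of \<open>V\<^sub>-\<close> under the unipotent element
  with blocks \<open>1, X, 0, 1\<close>, which also makes \<open>X \<mapsto> graph X\<close> continuous. Since graphs of finitary maps always
  lie in the flag manifold, the action of \<open>G\<^sub>0\<close> can be read off from graphs, without multiplicativity
  of the determinant. Openness reduces, block by block, to positivity of a quadratic form on a compact sphere,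
  and connectedness holds because the matrix domain is star-shaped.
\<close>

section \<open>Quaternionic coordinates\<close>

text \<open>If \<open>q\<close> is infinite, injectivity of the projection to the negative part does
  not give surjectivity. The argument is rescued by finite support: in the frame supplied by
  \<open>g\<close> this projection differs from the identity only in a \<open>T\<close> by
  \<open>T\<close> block with \<open>T\<close> finite, so surjectivity becomes a count of finitely
  many quaternionic equations and unknowns. The same finite support makes the slope finitary and not
  merely contractive. \<open>negative_frame\<close> isolates exactly this data because it occurs
  twice: for the image of \<open>V_-\<close> under a group element, and for the image of a graph
  under an element of \<open>G_0\<close>. Infinite \<open>q\<close> also deprives the unit sphere of
  \<open>V_-\<close> of compactness; the compactness argument therefore runs inside a fixed finite
  block, which suffices because the coordinates outside the block only add a nonnegative amount to
  the form in question.\<close>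

abbreviation lk :: "('i \<Rightarrow>\<^sub>0 quat) \<Rightarrow> 'i \<Rightarrow> quat" where "lk \<equiv> Poly_Mapping.lookup"

abbreviation bv :: "'i \<Rightarrow> ('i \<Rightarrow>\<^sub>0 quat)" where "bv i \<equiv> Poly_Mapping.single i 1"

lemma qcnj_0 [simp]: "qcnj 0 = 0"
  by (simp add: qcnj_def zero_quat_def)

lemma qcnj_qcnj [simp]: "qcnj (qcnj a) = a"
  by (simp add: qcnj_def)

lemma qcnj_eq_0_iff [simp]: "qcnj a = 0 \<longleftrightarrow> a = 0"
  by (auto simp: qcnj_def zero_quat_def quat_eq_iff)

lemma qcnj_add: "qcnj (a + b) = qcnj a + qcnj b"
  by (simp add: qcnj_def plus_quat_def)

lemma qcnj_mult: "qcnj (a * b) = qcnj b * qcnj a"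
  by (simp add: qcnj_def times_quat_def algebra_simps)

lemma qcnj_sum: "qcnj (sum f A) = (\<Sum>x\<in>A. qcnj (f x))"
  by (induction A rule: infinite_finite_induct) (simp_all add: qcnj_add)

lemma qre_add: "qre (a + b) = qre a + qre b"
  by (simp add: plus_quat_def)

lemma qre_diff: "qre (a - b) = qre a - qre b"
  by (simp add: minus_quat_def)

lemma qre_sum: "qre (sum f A) = (\<Sum>x\<in>A. qre (f x))"
  by (induction A rule: infinite_finite_induct) (simp_all add: qre_add, simp_all add: zero_quat_def)

lemma norm_quat_squared: "(norm a)\<^sup>2 = qnorm2 a"
  by (simp add: norm_quat_def qnorm2_nonneg)

lemma qre_qcnj_mult_self: "qre (qcnj a * a) = (norm a)\<^sup>2"
  by (simp add: qcnj_mult_self norm_quat_squared scaleR_quat_def one_quat_def)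

lemma of_real_mult_commute_quat: "of_real r * (a :: quat) = a * of_real r"
  by (simp add: of_real_def)

section \<open>Linear maps and their entries\<close>

lemma lk_rscale [simp]: "lk (x *\<^sub>H a) i = lk x i * a"
  by (simp add: lookup_rscale rscale_quat_def)

lemma rscale_0_left [simp]: "(0 :: 'a::right_hspace) *\<^sub>H a = 0"
  by (rule rscale_zero_left)

lemma rscale_0_right [simp]: "(x :: 'a::right_hspace) *\<^sub>H 0 = 0"
  using rscale_add_right[of x 0 0] by simp

lemma rscale_minus_right: "(x :: 'a::right_hspace) *\<^sub>H (- a) = - (x *\<^sub>H a)"
proof -
  have "x *\<^sub>H a + x *\<^sub>H (- a) = 0" by (simp flip: rscale_add_right)
  then show ?thesis by (simp add: minus_unique)
qed

lemma hlinear_add: "hlinear f \<Longrightarrow> f (x + y) = f x + f y"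
  by (simp add: hlinear_def)

lemma hlinear_rscale: "hlinear f \<Longrightarrow> f (x *\<^sub>H a) = f x *\<^sub>H a"
  by (simp add: hlinear_def)

lemma hlinear_0: "hlinear f \<Longrightarrow> f 0 = 0"
  by (metis add_cancel_right_left hlinear_add)

lemma hlinear_minus: "hlinear f \<Longrightarrow> f (- x) = - f x"
  using hlinear_add[of f x "- x"] hlinear_0[of f] minus_unique[of "f x" "f (- x)"] by simp

lemma hlinear_diff: "hlinear f \<Longrightarrow> f (x - y) = f x - f y"
  using hlinear_add[of f x "- y"] by (simp add: hlinear_minus)

lemma hlinear_sum: "hlinear f \<Longrightarrow> f (sum g A) = (\<Sum>i\<in>A. f (g i))"
  by (induction A rule: infinite_finite_induct) (simp_all add: hlinear_0 hlinear_add)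

lemma hlinear_comp: "hlinear f \<Longrightarrow> hlinear g \<Longrightarrow> hlinear (\<lambda>x. f (g x))"
  by (simp add: hlinear_def)

lemma hlinear_plus: "hlinear f \<Longrightarrow> hlinear g \<Longrightarrow> hlinear (\<lambda>x. f x + g x)"
  by (simp add: hlinear_def rscale_add_left add_ac)

lemma hlinear_inj:
  assumes "hlinear f" "\<And>x. f x = 0 \<Longrightarrow> x = 0"
  shows "inj f"
proof (rule injI)
  fix x y assume "f x = f y"
  then have "f (x - y) = 0" by (simp add: hlinear_diff assms(1))
  then show "x = y" using assms(2) by fastforce
qed

lemma hlinear_inv:
  assumes "hlinear f" "bij f"
  shows "hlinear (inv f)"
proof -
  note [simp] = bij_is_surj[OF assms(2)] surj_f_inv_f bij_is_inj[OF assms(2)]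
  have "inv f (x + y) = inv f x + inv f y" for x y
    by (rule inv_f_eq) (simp_all add: hlinear_add assms(1))
  moreover have "inv f (x *\<^sub>H a) = inv f x *\<^sub>H a" for x a
    by (rule inv_f_eq) (simp_all add: hlinear_rscale assms(1))
  ultimately show ?thesis by (simp add: hlinear_def)
qed

lemma basis_expansion: "finite A \<Longrightarrow> Poly_Mapping.keys x \<subseteq> A \<Longrightarrow> x = (\<Sum>i\<in>A. bv i *\<^sub>H lk x i)"
  by (rule poly_mapping_eqI)
    (auto simp: lookup_sum lookup_single when_def if_distrib[of "\<lambda>a. a * _"] sum.delta in_keys_iff
      cong: if_cong)

lemma lk_hlinear:
  assumes "hlinear f" "finite A" "Poly_Mapping.keys x \<subseteq> A"
  shows "lk (f x) i = (\<Sum>j\<in>A. entry f i j * lk x j)"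
proof -
  have "f x = f (\<Sum>j\<in>A. bv j *\<^sub>H lk x j)"
    using basis_expansion[OF assms(2,3)] by simp
  also have "\<dots> = (\<Sum>j\<in>A. f (bv j) *\<^sub>H lk x j)"
    by (simp add: assms(1) hlinear_sum hlinear_rscale)
  finally show ?thesis by (simp add: lookup_sum entry_def)
qed

text \<open>Gaussian elimination over a skew field, removing one equation at a time. The
  coefficients stand to the left of the unknowns, so row operations multiply from the left and
  commutativity never enters. This plays the role of dimension counting for right quaternionic
  spaces.\<close>

lemma homogeneous_system_nontrivial_solution:
  fixes M :: "'t \<Rightarrow> 'j \<Rightarrow> quat"
  assumes "finite T" "finite J" "card T < card J"
  shows "\<exists>a. (\<exists>j\<in>J. a j \<noteq> 0) \<and> (\<forall>j. j \<notin> J \<longrightarrow> a j = 0) \<and> (\<forall>t\<in>T. (\<Sum>j\<in>J. M t j * a j) = 0)"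
  using assms
proof (induction T arbitrary: J M rule: finite_induct)
  case empty
  then obtain j where "j \<in> J" by fastforce
  then show ?case by (intro exI[of _ "\<lambda>i. if i = j then 1 else 0"]) auto
next
  case (insert t T)
  show ?case
  proof (cases "\<forall>j\<in>J. M t j = 0")
    case True
    have "card T < card J" using insert.prems insert.hyps by simp
    from insert.IH[OF insert.prems(1) this, of M] obtain a where
      "\<exists>j\<in>J. a j \<noteq> 0" "\<forall>j. j \<notin> J \<longrightarrow> a j = 0" "\<forall>t\<in>T. (\<Sum>j\<in>J. M t j * a j) = 0" by blast
    with True show ?thesis by (intro exI[of _ a]) simp
  next
    case False
    then obtain j0 where j0: "j0 \<in> J" "M t j0 \<noteq> 0" by auto
    define c where "c = inverse (M t j0)"
    define J' where "J' = J - {j0}"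
    have J: "J = insert j0 J'" "j0 \<notin> J'" "finite J'"
      using j0 insert.prems by (auto simp: J'_def)
    have "card T < card J'" using insert.prems insert.hyps J by simp
    \<comment> \<open>Row \<open>s\<close> minus \<open>M s j0 * c\<close> times row
      \<open>t\<close>: the unknown at \<open>j0\<close> cancels.\<close>
    from insert.IH[OF J(3) this, of "\<lambda>s j. M s j - M s j0 * c * M t j"]
    obtain a where a: "\<exists>j\<in>J'. a j \<noteq> 0" "\<forall>j. j \<notin> J' \<longrightarrow> a j = 0"
      "\<forall>s\<in>T. (\<Sum>j\<in>J'. (M s j - M s j0 * c * M t j) * a j) = 0" by blast
    \<comment> \<open>Back substitution: the value at \<open>j0\<close> is the one that solves
      equation \<open>t\<close>.\<close>
    define b where "b = a(j0 := - c * (\<Sum>j\<in>J'. M t j * a j))"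
    have ba: "(\<Sum>j\<in>J'. M s j * b j) = (\<Sum>j\<in>J'. M s j * a j)" for s
      using J(2) by (intro sum.cong) (auto simp: b_def)
    have s: "(\<Sum>j\<in>J. M s j * b j) = (\<Sum>j\<in>J'. M s j * a j) - M s j0 * c * (\<Sum>j\<in>J'. M t j * a j)" for s
      unfolding J(1) sum.insert[OF J(3,2)] ba by (simp add: b_def mult.assoc)
    have "(\<Sum>j\<in>J. M t j * b j) = 0"
      unfolding s using j0 by (simp add: c_def)
    moreover have "(\<Sum>j\<in>J. M s j * b j) = 0" if "s \<in> T" for s
      using a(3) that unfolding s
      by (simp add: left_diff_distrib sum_subtractf sum_distrib_left mult.assoc)
    moreover have "\<exists>j\<in>J. b j \<noteq> 0" using a(1) J(2) by (auto simp: b_def J(1))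
    moreover have "\<forall>j. j \<notin> J \<longrightarrow> b j = 0" using a(2) by (auto simp: b_def J(1))
    ultimately show ?thesis by blast
  qed
qed

section \<open>The norm and the matrix domain\<close>

lemma herm_eq_sum_left:
  assumes "finite A" "Poly_Mapping.keys x \<subseteq> A"
  shows "herm x y = (\<Sum>i\<in>A. qcnj (lk x i) * lk y i)"
  unfolding herm_def using assms by (intro sum.mono_neutral_left) (auto simp: in_keys_iff)

lemma herm_eq_sum_right:
  assumes "finite A" "Poly_Mapping.keys y \<subseteq> A"
  shows "herm x y = (\<Sum>i\<in>A. qcnj (lk x i) * lk y i)"
proof -
  have "herm x y = (\<Sum>i\<in>A \<union> Poly_Mapping.keys x. qcnj (lk x i) * lk y i)"
    using assms by (intro herm_eq_sum_left) auto
  also have "\<dots> = (\<Sum>i\<in>A. qcnj (lk x i) * lk y i)"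
    using assms by (intro sum.mono_neutral_right) (auto simp: in_keys_iff)
  finally show ?thesis .
qed

lemma qcnj_diff: "qcnj (a - b) = qcnj a - qcnj b"
  by (simp add: qcnj_def minus_quat_def)

lemma herm_diff_right: "herm x (y - z) = herm x y - herm x z"
  by (simp add: herm_def lookup_minus right_diff_distrib sum_subtractf)

lemma qcnj_herm: "qcnj (herm x y) = herm y x"
  unfolding herm_eq_sum_right[OF finite_keys order_refl, of y x]
  by (simp add: herm_eq_sum_left[OF finite_keys order_refl] qcnj_sum qcnj_mult)

lemma herm_diff_left: "herm (x - y) z = herm x z - herm y z"
  by (metis qcnj_herm qcnj_diff herm_diff_right)

lemma hnorm_eq_L2_set:
  assumes "finite A" "Poly_Mapping.keys x \<subseteq> A"
  shows "hnorm x = L2_set (\<lambda>i. norm (lk x i)) A"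
  unfolding hnorm_def L2_set_def herm_eq_sum_left[OF assms] qre_sum qre_qcnj_mult_self ..

lemma hnorm_nonneg [simp]: "0 \<le> hnorm x"
  by (simp add: hnorm_eq_L2_set[OF finite_keys order_refl])

lemma qre_herm_self: "qre (herm x x) = (hnorm x)\<^sup>2"
  unfolding hnorm_def herm_eq_sum_left[OF finite_keys order_refl] qre_sum qre_qcnj_mult_self
  by (simp add: sum_nonneg)

lemma hnorm_0 [simp]: "hnorm 0 = 0"
  by (simp add: hnorm_def herm_zero zero_quat_def)

lemma hnorm_eq_0_iff [simp]: "hnorm x = 0 \<longleftrightarrow> x = 0"
  by (auto simp: hnorm_eq_L2_set[OF finite_keys order_refl] L2_set_eq_0_iff in_keys_iff
      intro!: poly_mapping_eqI)

lemma norm_lk_le_hnorm: "norm (lk x i) \<le> hnorm x"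
  by (cases "i \<in> Poly_Mapping.keys x")
    (auto simp: hnorm_eq_L2_set[OF finite_keys order_refl] in_keys_iff intro: member_le_L2_set)

lemma hnorm_rscale: "hnorm (x *\<^sub>H a) = hnorm x * norm a"
proof -
  have "hnorm (x *\<^sub>H a) = L2_set (\<lambda>i. norm (lk (x *\<^sub>H a) i)) (Poly_Mapping.keys x)"
    by (rule hnorm_eq_L2_set) (auto simp: in_keys_iff)
  then show ?thesis
    by (simp add: norm_mult L2_set_left_distrib hnorm_eq_L2_set[OF finite_keys order_refl])
qed

lemma lk_map_of_matrix:
  assumes "\<And>j. finite {i. M i j \<noteq> 0}"
  shows "lk (map_of_matrix M x) i = (\<Sum>j\<in>Poly_Mapping.keys x. M i j * lk x j)"
  unfolding map_of_matrix_def lookup_sum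
  using assms by (intro sum.cong refl) (auto simp: lookup_single when_def sum.delta)

lemma herm_conj_transpose:
  assumes "finitary X"
  shows "herm (conj_transpose X u) y = herm u (X y)"
proof -
  have lin: "hlinear X" and fin: "finite {(i, j). entry X i j \<noteq> 0}"
    using assms by (auto simp: finitary_def)
  \<comment> \<open>The columns of the conjugate transpose are the rows of \<open>X\<close>. Their
    finiteness comes from \<open>X\<close> being finitary; a general linear map has finite columns
    only.\<close>
  have "finite {j. qcnj (entry X i j) \<noteq> 0}" for i
    by (rule finite_subset[OF _ finite_imageI[OF fin, of snd]]) (auto simp: image_iff Bex_def)
  then have *: "lk (conj_transpose X u) j = (\<Sum>i\<in>Poly_Mapping.keys u. qcnj (entry X i j) * lk u i)" for j
    unfolding conj_transpose_def by (rule lk_map_of_matrix)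
  have "herm (conj_transpose X u) y =
      (\<Sum>j\<in>Poly_Mapping.keys y. \<Sum>i\<in>Poly_Mapping.keys u. qcnj (lk u i) * (entry X i j * lk y j))"
    by (simp add: herm_eq_sum_right[OF finite_keys order_refl] * qcnj_sum qcnj_mult
        sum_distrib_right mult.assoc)
  also have "\<dots> = herm u (X y)"
    by (subst sum.swap)
      (simp add: herm_eq_sum_left[OF finite_keys order_refl]
        lk_hlinear[OF lin finite_keys order_refl] sum_distrib_left)
  finally show ?thesis .
qed

text \<open>Moving the adjoint across turns both sides of the symmetry clause into
  \<open>herm y z - herm (X y) (X z)\<close>; on the diagonal this is the difference of the squared
  norms. From here on the matrix domain is handled as the set of finitary strict
  contractions.\<close>

lemma matrix_domain_iff:
  "X \<in> matrix_domain \<longleftrightarrow> finitary X \<and> (\<forall>y. y \<noteq> 0 \<longrightarrow> hnorm (X y) < hnorm y)"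
proof (cases "finitary X")
  case True
  let ?T = "\<lambda>y. y - conj_transpose X (X y)"
  have right: "herm y (?T z) = herm y z - herm (X y) (X z)" for y z
    unfolding herm_diff_right
    by (subst (2) qcnj_herm[symmetric]) (simp add: herm_conj_transpose[OF True] qcnj_herm)
  have left: "herm (?T y) z = herm y z - herm (X y) (X z)" for y z
    by (simp add: herm_diff_left herm_conj_transpose[OF True])
  have "0 < qre (herm y (?T y)) \<longleftrightarrow> hnorm (X y) < hnorm y" for y
    unfolding right qre_diff qre_herm_self
    using power_mono_iff[of "hnorm y" "hnorm (X y)" 2] by (simp add: not_le[symmetric])
  then show ?thesis using True by (simp add: matrix_domain_def pos_def_def left right)
qed (simp add: matrix_domain_def)

section \<open>Finite blocks of finitary maps\<close>

lemma hlinear_if_finitary_block: "X \<in> finitary_block S T \<Longrightarrow> hlinear X"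
  by (simp add: finitary_block_def)

lemma finitary_if_finitary_block:
  assumes "X \<in> finitary_block S T" "finite S" "finite T"
  shows "finitary X"
proof -
  have "{(i, j). entry X i j \<noteq> 0} \<subseteq> S \<times> T" using assms(1) by (auto simp: finitary_block_def)
  then show ?thesis
    using assms by (auto simp: finitary_block_def finitary_def intro: finite_subset)
qed

lemma finitary_imp_finitary_block:
  assumes "finitary X"
  obtains S T where "finite S" "finite T" "X \<in> finitary_block S T"
proof
  let ?E = "{(i, j). entry X i j \<noteq> 0}"
  show "finite (fst ` ?E)" "finite (snd ` ?E)" using assms by (simp_all add: finitary_def)
  show "X \<in> finitary_block (fst ` ?E) (snd ` ?E)"
    using assms by (force simp: finitary_def finitary_block_def)
qed

lemma lk_finitary_block:
  assumes "X \<in> finitary_block S T" "i \<notin> S"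
  shows "lk (X y) i = 0"
proof -
  have "entry X i j = 0" for j using assms by (auto simp: finitary_block_def)
  then show ?thesis
    by (simp add: lk_hlinear[OF hlinear_if_finitary_block[OF assms(1)] finite_keys order_refl])
qed

lemma finitary_block_bv:
  assumes "X \<in> finitary_block S T" "j \<notin> T"
  shows "X (bv j) = 0"
  using assms by (intro poly_mapping_eqI) (auto simp: finitary_block_def entry_def)

text \<open>The columns of \<open>N\<close> and \<open>Q\<close> are the plus and minus parts of an \<open>\<H>\<close>-basis of a negative
  definite subspace; outside a finite block this basis is the standard one.\<close>

locale negative_frame =
  fixes S :: "nat set" and T :: "'j set"
    and N :: "('j \<Rightarrow>\<^sub>0 quat) \<Rightarrow> hplus" and Q :: "('j \<Rightarrow>\<^sub>0 quat) \<Rightarrow> ('j \<Rightarrow>\<^sub>0 quat)"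
  assumes finite_T: "finite T"
    and lin_N: "hlinear N" and lin_Q: "hlinear Q"
    and N_row: "\<And>i y. i \<notin> S \<Longrightarrow> lk (N y) i = 0"
    and Q_row: "\<And>j y. j \<notin> T \<Longrightarrow> lk (Q y) j = lk y j"
    and N_column: "\<And>j. j \<notin> T \<Longrightarrow> N (bv j) = 0"
    and Q_column: "\<And>j. j \<notin> T \<Longrightarrow> Q (bv j) = bv j"
    and negative: "\<And>y. y \<noteq> 0 \<Longrightarrow> hnorm (N y) < hnorm (Q y)"
begin

lemma inj_Q: "inj Q"
proof (rule hlinear_inj[OF lin_Q])
  fix x assume "Q x = 0"
  then show "x = 0" using negative[of x] hnorm_nonneg[of "N x"] by (cases "x = 0") auto
qed

text \<open>Since \<open>z - Q z\<close> is supported in \<open>T\<close>, it suffices to reach such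
  a vector \<open>w\<close>. The equation \<open>Q y = w a\<close> with \<open>y\<close> supported
  in \<open>T\<close> has \<open>card T\<close> rows and \<open>card T + 1\<close> unknowns, the
  coordinates of \<open>y\<close> and the scalar \<open>a\<close>. In a nontrivial solution
  \<open>a\<close> is nonzero, for otherwise \<open>y\<close> would lie in the kernel of the
  injective \<open>Q\<close>.\<close>

lemma bij_Q: "bij Q"
proof -
  have "\<exists>y. Q y = z" for z
  proof -
    define w where "w = z - Q z"
    have w: "lk w j = 0" if "j \<notin> T" for j
      using that by (simp add: w_def lookup_minus Q_row)
    \<comment> \<open>The index \<open>None\<close> stands for the scalar attached to the column
      \<open>- w\<close>, the indices \<open>Some j\<close> for the coordinates of
      \<open>y\<close>.\<close>
    define M where "M = (\<lambda>t l. case l of None \<Rightarrow> - lk w t | Some j \<Rightarrow> entry Q t j)"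
    define J where "J = insert None (Some ` T)"
    have "finite J" "card T < card J"
      using finite_T by (simp_all add: J_def card_image)
    from homogeneous_system_nontrivial_solution[OF finite_T this, of M]
    obtain a where a: "\<exists>l\<in>J. a l \<noteq> 0" "\<forall>t\<in>T. (\<Sum>l\<in>J. M t l * a l) = 0" by blast
    define y where "y = (\<Sum>j\<in>T. bv j *\<^sub>H a (Some j))"
    have lk_y: "lk y j = (if j \<in> T then a (Some j) else 0)" for j
      using finite_T by (simp add: y_def lookup_sum lookup_single when_def
          if_distrib[of "\<lambda>c. c * _"] sum.delta cong: if_cong)
    have keys_y: "Poly_Mapping.keys y \<subseteq> T" by (auto simp: in_keys_iff lk_y split: if_splits)
    have "Q y = w *\<^sub>H a None"
    proof (rule poly_mapping_eqI)
      fix t show "lk (Q y) t = lk (w *\<^sub>H a None) t"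
      proof (cases "t \<in> T")
        case True
        have "(\<Sum>l\<in>J. M t l * a l) = (\<Sum>j\<in>T. entry Q t j * a (Some j)) - lk w t * a None"
          unfolding J_def using finite_T by (simp add: sum.reindex M_def)
        moreover have "lk (Q y) t = (\<Sum>j\<in>T. entry Q t j * a (Some j))"
          by (simp add: lk_hlinear[OF lin_Q finite_T keys_y] lk_y)
        ultimately show ?thesis using a(2) True by simp
      next
        case False
        then show ?thesis by (simp add: Q_row lk_y w)
      qed
    qed
    moreover have "a None \<noteq> 0"
    proof
      assume 0: "a None = 0"
      with calculation have "Q y = Q 0" by (simp add: hlinear_0 lin_Q)
      then have "y = 0" using inj_Q by (simp add: inj_eq)
      then have "a (Some j) = 0" if "j \<in> T" for j using lk_y[of j] that by simp
      with 0 a(1) show False by (auto simp: J_def)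
    qed
    \<comment> \<open>The first summand is a preimage of \<open>w = z - Q z\<close>; adding
      \<open>z\<close> supplies the missing \<open>Q z\<close>.\<close>
    ultimately have "Q (y *\<^sub>H inverse (a None) + z) = z"
      by (simp add: hlinear_add hlinear_rscale lin_Q rscale_rscale rscale_one)
        (simp add: w_def)
    then show ?thesis ..
  qed
  then have "surj Q" by (auto simp: surj_def eq_commute)
  with inj_Q show ?thesis by (simp add: bij_def)
qed

lemma Q_inv [simp]: "Q (inv Q y) = y"
  by (simp add: bij_Q bij_is_surj surj_f_inv_f)

lemma inv_Q [simp]: "inv Q (Q y) = y"
  by (simp add: inj_Q)

text \<open>For \<open>j\<close> outside \<open>T\<close> the vector \<open>bv j\<close> is fixed by
  \<open>Q\<close>, hence by \<open>inv Q\<close>, and is annihilated by \<open>N\<close>. The block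
  depends on \<open>S\<close> and \<open>T\<close> alone; thus the slopes of all relevant elements
  of one \<open>SL_block U\<close> later lie in a single block topology.\<close>

lemma slope_in_finitary_block: "N \<circ> inv Q \<in> finitary_block S T"
proof -
  have "hlinear (N \<circ> inv Q)"
    unfolding comp_def by (rule hlinear_comp[OF lin_N hlinear_inv[OF lin_Q bij_Q]])
  moreover have "i \<in> S \<and> j \<in> T" if "entry (N \<circ> inv Q) i j \<noteq> 0" for i j
  proof (rule ccontr)
    assume "\<not> (i \<in> S \<and> j \<in> T)"
    moreover have "inv Q (bv j) = bv j" if "j \<notin> T" using Q_column[OF that] by (metis inv_Q)
    ultimately show False using that by (auto simp: entry_def N_row N_column)
  qed
  ultimately show ?thesis by (simp add: finitary_block_def)
qed

lemma slope_in_matrix_domain: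
  assumes "finite S"
  shows "N \<circ> inv Q \<in> matrix_domain"
  unfolding matrix_domain_iff
proof (intro conjI allI impI)
  show "finitary (N \<circ> inv Q)"
    using slope_in_finitary_block assms finite_T by (rule finitary_if_finitary_block)
  fix y :: "'j \<Rightarrow>\<^sub>0 quat" assume "y \<noteq> 0"
  then have "inv Q y \<noteq> 0" using Q_inv[of y] by (metis hlinear_0 lin_Q)
  from negative[OF this] show "hnorm ((N \<circ> inv Q) y) < hnorm y" by simp
qed

lemma range_frame: "range (\<lambda>y. (N y, Q y)) = range (\<lambda>y. ((N \<circ> inv Q) y, y))"
proof (intro equalityI image_subsetI)
  show "(N y, Q y) \<in> range (\<lambda>y. ((N \<circ> inv Q) y, y))" for y
    by (rule range_eqI[of _ _ "Q y"]) simp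
  show "((N \<circ> inv Q) y, y) \<in> range (\<lambda>y. (N y, Q y))" for y
    by (rule range_eqI[of _ _ "inv Q y"]) simp
qed

end

section \<open>Flags and graphs\<close>

lemma fst_rscale [simp]: "fst (x *\<^sub>H a) = fst x *\<^sub>H a"
  and snd_rscale [simp]: "snd (x *\<^sub>H a) = snd x *\<^sub>H a"
  by (simp_all add: rscale_prod_def)

section \<open>Block decomposition of group elements\<close>

lemma hlinear_blocks:
  assumes "hlinear g"
  shows "hlinear (block_A g)" "hlinear (block_B g)" "hlinear (block_C g)" "hlinear (block_D g)"
proof -
  have "g (x + y, 0) = g (x, 0) + g (y, 0)" "g (0, x' + y') = g (0, x') + g (0, y')" for x y x' y'
    by (simp_all flip: hlinear_add[OF assms])
  moreover have "g (x *\<^sub>H a, 0) = g (x, 0) *\<^sub>H a" "g (0, x' *\<^sub>H a) = g (0, x') *\<^sub>H a" for x x' a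
    using hlinear_rscale[OF assms, of "(x, 0)" a] hlinear_rscale[OF assms, of "(0, x')" a]
    by (simp_all add: rscale_prod_def)
  ultimately show "hlinear (block_A g)" "hlinear (block_B g)" "hlinear (block_C g)" "hlinear (block_D g)"
    by (simp_all add: hlinear_def block_A_def block_B_def block_C_def block_D_def)
qed

lemma block_decomposition:
  assumes "hlinear g"
  shows "g (x, y) = (block_A g x + block_B g y, block_C g x + block_D g y)"
  using hlinear_add[OF assms, of "(x, 0)" "(0, y)"]
  by (simp add: block_A_def block_B_def block_C_def block_D_def prod_eq_iff)

lemma entry_blocks:
  "entry (block_A g) i i' = gentry g (Inl i) (Inl i')" "entry (block_B g) i j = gentry g (Inl i) (Inr j)"
  "entry (block_C g) j i = gentry g (Inr j) (Inl i)" "entry (block_D g) j j' = gentry g (Inr j) (Inr j')"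
  by (simp_all add: entry_def gentry_def block_A_def block_B_def block_C_def block_D_def)

lemma hlinear_if_SL_block: "g \<in> SL_block U \<Longrightarrow> hlinear g"
  and bij_if_SL_block: "g \<in> SL_block U \<Longrightarrow> bij g"
  and SL_block_vbasis: "g \<in> SL_block U \<Longrightarrow> l \<notin> U \<Longrightarrow> g (vbasis l) = vbasis l"
  by (simp_all add: SL_block_def)

lemma coord_vbasis: "coord (vbasis l) k = (if k = l then 1 else 0)"
  by (cases k; cases l) (auto simp: lookup_single when_def)

lemma gentry_outside_row:
  assumes "g \<in> SL_block U" "k \<notin> U"
  shows "gentry g k l = (if k = l then 1 else 0)"
proof (cases "l \<in> U")
  case True
  then show ?thesis using assms by (auto simp: SL_block_def)
next
  case False
  then show ?thesis by (simp add: gentry_def SL_block_vbasis[OF assms(1)] coord_vbasis)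
qed

lemma sum_indicator_keys:
  "(\<Sum>j\<in>Poly_Mapping.keys x. (if i = j then 1 else 0) * lk x j) = lk x i"
  by (simp add: if_distrib[of "\<lambda>c. c * _"] in_keys_iff cong: if_cong)

lemma blocks_outside_row:
  assumes g: "g \<in> SL_block U"
  shows "Inl i \<notin> U \<Longrightarrow> lk (block_A g x) i = lk x i" "Inl i \<notin> U \<Longrightarrow> lk (block_B g y) i = 0"
    "Inr j \<notin> U \<Longrightarrow> lk (block_C g x) j = 0" "Inr j \<notin> U \<Longrightarrow> lk (block_D g y) j = lk y j"
  by (simp_all add: lk_hlinear[OF _ finite_keys order_refl] hlinear_blocks hlinear_if_SL_block[OF g]
      entry_blocks gentry_outside_row[OF g] sum_indicator_keys)

lemma blocks_outside_column:
  assumes g: "g \<in> SL_block U" and "Inr j \<notin> U"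
  shows "block_B g (bv j) = 0" "block_D g (bv j) = bv j"
  using SL_block_vbasis[OF assms] by (simp_all add: block_B_def block_D_def)

lemma qre_hform_self: "qre (hform x x) = (hnorm (proj_plus x))\<^sup>2 - (hnorm (proj_minus x))\<^sup>2"
  by (simp add: hform_def qre_diff qre_herm_self)

lemma qre_hform_self_neg_iff: "qre (hform x x) < 0 \<longleftrightarrow> hnorm (proj_plus x) < hnorm (proj_minus x)"
  unfolding qre_hform_self
  using power_mono_iff[of "hnorm (proj_minus x)" "hnorm (proj_plus x)" 2]
  by (simp add: not_le[symmetric])

section \<open>Graphs and their maximality\<close>

definition graph_flag :: "('q hminus \<Rightarrow> hplus) \<Rightarrow> 'q hflag"
  where "graph_flag X = ({0}, range (\<lambda>y. (X y, y)), UNIV)"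

lemma graph_map_graph_flag [simp]: "graph_map (graph_flag X) = X"
  by (rule ext) (simp add: graph_map_def graph_flag_def)

text \<open>Any \<open>x\<close> in a larger negative definite space differs from the graph point
  over \<open>proj_minus x\<close> by a vector of that space with zero minus part. The form is
  nonnegative on such vectors, so the difference vanishes.\<close>

lemma max_neg_definite_graph:
  assumes "hlinear X" "\<And>y. y \<noteq> 0 \<Longrightarrow> hnorm (X y) < hnorm y"
  shows "max_neg_definite (range (\<lambda>y. (X y, y)))" (is "max_neg_definite ?E")
  unfolding max_neg_definite_def
proof (intro conjI allI impI)
  have "(X y, y) + (X z, z) = (X (y + z), y + z)" for y z
    by (simp add: hlinear_add assms(1))
  moreover have "(X y, y) *\<^sub>H a = (X (y *\<^sub>H a), y *\<^sub>H a)" for y a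
    by (simp add: rscale_prod_def hlinear_rscale assms(1))
  moreover have "0 = (X 0, 0)" by (simp add: hlinear_0 assms(1) zero_prod_def)
  ultimately show "hsubspace ?E" unfolding hsubspace_def by auto
  have "y \<noteq> 0" if "(X y, y) \<noteq> 0" for y
    using that by (auto simp: hlinear_0 assms(1) zero_prod_def)
  then show "neg_definite ?E"
    by (auto simp: neg_definite_def qre_hform_self_neg_iff assms(2))
  fix E assume E: "hsubspace E \<and> neg_definite E \<and> ?E \<subseteq> E"
  have "x \<in> ?E" if "x \<in> E" for x
  proof -
    define y where "y = snd x"
    define d where "d = x + (X y, y) *\<^sub>H (- 1)"
    have "(X y, y) \<in> E" using E by auto
    then have "d \<in> E" using E that by (auto simp: hsubspace_def d_def)
    moreover have "snd d = 0"
      by (simp add: d_def y_def rscale_minus_right rscale_one)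
    ultimately have "d = 0"
      using E hnorm_nonneg[of "fst d"] unfolding neg_definite_def qre_hform_self_neg_iff
      by (metis hnorm_0 not_le)
    then have "x = (X y, y)"
      by (simp add: d_def y_def rscale_minus_right rscale_one prod_eq_iff)
    then show ?thesis by blast
  qed
  with E show "E = ?E" by blast
qed

lemma flag_act_base_flag:
  assumes "g \<in> SL_block U"
  shows "flag_act g base_flag = ({0}, range (\<lambda>y. (block_B g y, block_D g y)), UNIV)"
proof -
  have g0: "g 0 = 0" using assms by (simp add: hlinear_0 hlinear_if_SL_block)
  have s: "range g = UNIV" using assms by (simp add: bij_if_SL_block bij_is_surj)
  have "g (0, y) = (block_B g y, block_D g y)" for y
    by (simp add: block_B_def block_D_def)
  moreover have "{x :: 'a hspace. proj_plus x = 0} = range (Pair 0)" by force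
  ultimately show ?thesis by (simp add: flag_act_def base_flag_def g0 s image_image)
qed

lemma negative_frame_SL_block:
  assumes g: "g \<in> SL_block U" and U: "finite U"
    and neg: "neg_definite (range (\<lambda>y. (block_B g y, block_D g y)))"
  shows "negative_frame (Inl -` U) (Inr -` U) (block_B g) (block_D g)"
proof
  show "finite (Inr -` U)" using U by (simp add: finite_vimageI)
  show "hlinear (block_B g)" "hlinear (block_D g)"
    using g by (simp_all add: hlinear_blocks hlinear_if_SL_block)
  show "hnorm (block_B g y) < hnorm (block_D g y)" if "y \<noteq> 0" for y
  proof -
    \<comment> \<open>Injectivity of \<open>g\<close> guarantees that a nonzero parameter
      \<open>y\<close> gives a nonzero vector, to which negative definiteness applies.\<close>
    have "g (0, y) \<noteq> g (0, 0)"
      using that bij_is_inj[OF bij_if_SL_block[OF g]] by (simp add: inj_eq)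
    then have "(block_B g y, block_D g y) \<noteq> 0"
      using hlinear_0[OF hlinear_if_SL_block[OF g]]
      by (simp add: block_B_def block_D_def flip: zero_prod_def)
    then show ?thesis using neg by (auto simp: neg_definite_def qre_hform_self_neg_iff)
  qed
qed (use g in \<open>simp_all add: blocks_outside_row blocks_outside_column\<close>)

section \<open>Unipotent group elements and their determinant\<close>

definition shear :: "('q hminus \<Rightarrow> hplus) \<Rightarrow> 'q hspace \<Rightarrow> 'q hspace"
  where "shear X = (\<lambda>(x, y). (x + X y, y))"

lemma hlinear_shear: "hlinear X \<Longrightarrow> hlinear (shear X)"
  by (auto simp: hlinear_def shear_def rscale_prod_def rscale_add_left)

lemma gentry_shear:
  assumes "hlinear X"
  shows "gentry (shear X) (Inl i) (Inl i') = (if i = i' then 1 else 0)"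
    "gentry (shear X) (Inl i) (Inr j) = entry X i j"
    "gentry (shear X) (Inr j) (Inl i) = 0"
    "gentry (shear X) (Inr j) (Inr j') = (if j = j' then 1 else 0)"
  by (auto simp: gentry_def shear_def entry_def hlinear_0[OF assms] lookup_single when_def)

lemma complexify_0: "complexify 0 s t = 0"
  by (cases s; cases t) (auto simp: zero_quat_def complex_eq_iff)

lemma complexify_1: "complexify 1 s t = (if s = t then 1 else 0)"
  by (cases s; cases t) (auto simp: one_quat_def complex_eq_iff)

text \<open>Only the identity permutation contributes. In a row indexed by \<open>Inr j\<close> the
  sole nonzero entry is on the diagonal, so a contributing \<open>p\<close> fixes every such index.
  By injectivity \<open>p\<close> then sends no \<open>Inl\<close> index to an \<open>Inr\<close>
  one, and in the remaining block the matrix is again the identity.\<close>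

lemma complex_det_unipotent:
  fixes M :: "'a + 'b \<Rightarrow> 'a + 'b \<Rightarrow> quat"
  assumes U: "finite U"
    and M: "\<And>i i'. M (Inl i) (Inl i') = (if i = i' then 1 else 0)"
      "\<And>i j. M (Inr j) (Inl i) = 0" "\<And>j j'. M (Inr j) (Inr j') = (if j = j' then 1 else 0)"
  shows "complex_det U M = 1"
proof -
  let ?c = "\<lambda>p. \<Prod>(k, s) \<in> U \<times> UNIV. complexify (M k (fst (p (k, s)))) s (snd (p (k, s)))"
  have fin: "finite (U \<times> (UNIV :: bool set))" using U by simp
  have "p = id" if p: "p permutes (U \<times> UNIV)" and nz: "?c p \<noteq> 0" for p
  proof -
    have nz': "complexify (M k (fst (p (k, s)))) s (snd (p (k, s))) \<noteq> 0" if "k \<in> U" for k s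
      using nz fin that by (auto simp: prod_zero_iff)
    have r: "p (Inr j, s) = (Inr j, s)" for j s
    proof (cases "Inr j \<in> U")
      case True
      from nz'[OF this, of s] show ?thesis
        by (cases "fst (p (Inr j, s))")
          (auto simp: M complexify_0 complexify_1 prod_eq_iff split: if_splits)
    next
      case False
      then show ?thesis using p by (simp add: permutes_not_in)
    qed
    have l: "p (Inl i, s) = (Inl i, s)" for i s
    proof (cases "Inl i \<in> U")
      case True
      have "p (Inl i, s) \<noteq> p (Inr j, t)" for j t
        using permutes_inj[OF p] by (simp add: inj_eq)
      then have "p (Inl i, s) \<noteq> (Inr j, t)" for j t by (simp add: r)
      then obtain i' where "fst (p (Inl i, s)) = Inl i'"
        by (metis prod.collapse sum.exhaust)
      with nz'[OF True, of s] show ?thesis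
        by (auto simp: M complexify_0 complexify_1 prod_eq_iff split: if_splits)
    next
      case False
      then show ?thesis using p by (simp add: permutes_not_in)
    qed
    show "p = id"
    proof
      fix x show "p x = id x" using l r by (cases x; cases "fst x") auto
    qed
  qed
  then have "complex_det U M = (\<Sum>p\<in>{id}. of_int (sign p) * ?c p)"
    unfolding complex_det_def using fin
    by (intro sum.mono_neutral_right) (auto simp: finite_permutations permutes_id)
  also have "M k k = 1" for k by (cases k) (simp_all add: M)
  then have "(\<Sum>p\<in>{id}. of_int (sign p) * ?c p) = 1"
    by (simp add: sign_id complexify_1)
  finally show ?thesis .
qed

lemma shear_in_SL_block:
  assumes X: "X \<in> finitary_block S T" and fin: "finite S" "finite T"
  shows "shear X \<in> SL_block (S <+> T)"
proof -
  note lin = hlinear_if_finitary_block[OF X]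
  have "bij (shear X)"
    by (rule bij_betw_byWitness[of _ "\<lambda>(x, y). (x - X y, y)"]) (auto simp: shear_def)
  moreover have "shear X (vbasis l) = vbasis l" if "l \<notin> S <+> T" for l
    using that finitary_block_bv[OF X] by (cases l) (auto simp: shear_def hlinear_0[OF lin])
  moreover have "gentry (shear X) k l = 0" if "l \<in> S <+> T" "k \<notin> S <+> T" for k l
    using that X by (cases k; cases l) (auto simp: gentry_shear[OF lin] finitary_block_def)
  moreover have "complex_det (S <+> T) (gentry (shear X)) = 1"
    using fin by (intro complex_det_unipotent) (auto simp: gentry_shear[OF lin])
  ultimately show ?thesis by (auto simp: SL_block_def hlinear_shear lin)
qed

lemma flag_act_shear:
  assumes "finitary X"
  shows "flag_act (shear X) base_flag = graph_flag X"
proof -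
  obtain S T where "finite S" "finite T" "X \<in> finitary_block S T"
    using assms by (rule finitary_imp_finitary_block)
  from flag_act_base_flag[OF shear_in_SL_block[OF this(3,1,2)]] show ?thesis
    by (simp add: graph_flag_def block_B_def block_D_def shear_def)
qed

lemma shear_in_SL_inf: "finitary X \<Longrightarrow> shear X \<in> SL_inf"
  by (metis (mono_tags, lifting) SL_inf_def UN_I finitary_imp_finitary_block finite_Plus
      mem_Collect_eq shear_in_SL_block)

lemma graph_flag_in_manifold: "finitary X \<Longrightarrow> graph_flag X \<in> flag_manifold"
  unfolding flag_manifold_def by (metis flag_act_shear image_eqI shear_in_SL_inf)

lemma graph_flag_in_flag_domain:
  assumes "X \<in> matrix_domain"
  shows "graph_flag X \<in> flag_domain"
  using assms max_neg_definite_graph[of X] graph_flag_in_manifold[of X]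
  by (simp add: matrix_domain_iff flag_domain_def finitary_def graph_flag_def)

section \<open>Slopes of flags in the domain and the action of the isometry group\<close>

lemma graph_flag_in_flag_domain_iff:
  assumes "finitary X"
  shows "graph_flag X \<in> flag_domain \<longleftrightarrow> X \<in> matrix_domain"
proof
  assume "graph_flag X \<in> flag_domain"
  then have neg: "neg_definite (range (\<lambda>y. (X y, y)))"
    by (simp add: flag_domain_def graph_flag_def max_neg_definite_def)
  have "hnorm (X y) < hnorm y" if "y \<noteq> 0" for y
    using neg that by (auto simp: neg_definite_def qre_hform_self_neg_iff zero_prod_def)
  then show "X \<in> matrix_domain" using assms by (simp add: matrix_domain_iff)
qed (rule graph_flag_in_flag_domain)

text \<open>The last block column of \<open>g\<close> is a negative frame of \<open>g V_-\<close>,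
  whose slope is \<open>B\<close> times the inverse of \<open>D\<close>: the fractional linear
  formula at \<open>X = 0\<close>. Maximality follows from negative definiteness, as the space turns
  out to be the graph of a strict contraction.\<close>

lemma flag_act_base_flag_in_flag_domain:
  assumes g: "g \<in> SL_block U" and U: "finite U"
    and neg: "neg_definite (range (\<lambda>y. (block_B g y, block_D g y)))"
  shows "flag_act g base_flag = graph_flag (block_B g \<circ> inv (block_D g))"
    "block_B g \<circ> inv (block_D g) \<in> finitary_block (Inl -` U) (Inr -` U) \<inter> matrix_domain"
proof -
  interpret negative_frame "Inl -` U" "Inr -` U" "block_B g" "block_D g"
    by (rule negative_frame_SL_block[OF assms])
  have "finite (Inl -` U)" using U by (simp add: finite_vimageI)
  then show "block_B g \<circ> inv (block_D g) \<in> finitary_block (Inl -` U) (Inr -` U) \<inter> matrix_domain"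
    using slope_in_finitary_block slope_in_matrix_domain by blast
  show "flag_act g base_flag = graph_flag (block_B g \<circ> inv (block_D g))"
    by (simp add: flag_act_base_flag[OF g] graph_flag_def range_frame)
qed

lemma flag_act_base_flag_in_flag_domain_iff:
  assumes "g \<in> SL_block U" "finite U"
  shows "flag_act g base_flag \<in> flag_domain \<longleftrightarrow> (\<forall>y. y \<noteq> 0 \<longrightarrow> hnorm (block_B g y) < hnorm (block_D g y))"
    (is "?L \<longleftrightarrow> ?R")
proof
  assume ?L
  then have "neg_definite (range (\<lambda>y. (block_B g y, block_D g y)))"
    by (simp add: flag_domain_def flag_act_base_flag[OF assms(1)] max_neg_definite_def)
  from negative_frame_SL_block[OF assms this] show ?R by (simp add: negative_frame.negative)
next
  assume R: ?R
  have "block_B g 0 = 0" "block_D g 0 = 0"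
    using assms(1) by (simp_all add: hlinear_0 hlinear_blocks hlinear_if_SL_block)
  then have "neg_definite (range (\<lambda>y. (block_B g y, block_D g y)))"
    using R by (metis (no_types, lifting) neg_definite_def qre_hform_self_neg_iff imageE
        fst_conv snd_conv zero_prod_def)
  from flag_act_base_flag_in_flag_domain[OF assms this] show ?L
    by (simp add: graph_flag_in_flag_domain)
qed

lemma flag_domain_eq: "flag_domain = graph_flag ` matrix_domain"
proof (intro equalityI subsetI)
  fix F :: "'q hflag" assume F: "F \<in> flag_domain"
  then obtain g U where g: "g \<in> SL_block U" "finite U" "F = flag_act g base_flag"
    by (auto simp: flag_domain_def flag_manifold_def SL_inf_def)
  have "neg_definite (range (\<lambda>y. (block_B g y, block_D g y)))"
    using F by (simp add: flag_domain_def flag_act_base_flag[OF g(1)] max_neg_definite_def g(3))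
  from flag_act_base_flag_in_flag_domain[OF g(1,2) this] show "F \<in> graph_flag ` matrix_domain"
    using g(3) by blast
qed (auto intro: graph_flag_in_flag_domain)

lemma bij_betw_graph_map: "bij_betw graph_map flag_domain matrix_domain"
  by (rule bij_betw_byWitness[of _ graph_flag]) (auto simp: flag_domain_eq)

text \<open>The point \<open>(X y, y)\<close> of the graph goes to \<open>(N y, Q y)\<close>, and
  invariance of the form keeps it negative. Hence \<open>N\<close> and \<open>Q\<close> form a
  negative frame, over the union of the blocks of \<open>g\<close> and of \<open>X\<close>, and the
  invertibility of \<open>CX + D\<close> is an instance of \<open>bij_Q\<close>.\<close>

lemma graph_map_flag_act:
  assumes g: "g \<in> Sp_inf" and X: "X \<in> matrix_domain"
  defines "N \<equiv> \<lambda>y. block_A g (X y) + block_B g y" and "Q \<equiv> \<lambda>y. block_C g (X y) + block_D g y"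
  shows "flag_act g (graph_flag X) \<in> flag_domain" "bij Q"
    "graph_map (flag_act g (graph_flag X)) = N \<circ> inv Q"
proof -
  obtain U where U: "finite U" "g \<in> SL_block U" using g by (auto simp: Sp_inf_def SL_inf_def)
  note lin = hlinear_if_SL_block[OF U(2)]
  have fX: "finitary X" using X by (simp add: matrix_domain_iff)
  then obtain S T where ST: "finite S" "finite T" "X \<in> finitary_block S T"
    by (rule finitary_imp_finitary_block)
  note linX = hlinear_if_finitary_block[OF ST(3)]
  have gX: "g (X y, y) = (N y, Q y)" for y
    unfolding N_def Q_def by (rule block_decomposition[OF lin])
  have fin: "finite (Inl -` U \<union> S)" using U ST by (simp add: finite_vimageI)
  interpret negative_frame "Inl -` U \<union> S" "Inr -` U \<union> T" N Q
  proof
    show "finite (Inr -` U \<union> T)" using U ST by (simp add: finite_vimageI)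
    show "hlinear N" "hlinear Q"
      unfolding N_def Q_def by (rule hlinear_plus hlinear_comp[OF _ linX] hlinear_blocks[OF lin])+
    show "hnorm (N y) < hnorm (Q y)" if "y \<noteq> 0" for y
    proof -
      have "qre (hform (X y, y) (X y, y)) < 0"
        using X that by (simp add: qre_hform_self_neg_iff matrix_domain_iff)
      moreover have "hform (g (X y, y)) (g (X y, y)) = hform (X y, y) (X y, y)"
        using g by (simp add: Sp_inf_def)
      ultimately have "qre (hform (N y, Q y) (N y, Q y)) < 0" by (simp add: gX)
      then show ?thesis by (simp add: qre_hform_self_neg_iff)
    qed
  qed (simp_all add: N_def Q_def lookup_add blocks_outside_row[OF U(2)]
      blocks_outside_column[OF U(2)] lk_finitary_block[OF ST(3)] finitary_block_bv[OF ST(3)]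
      hlinear_0 hlinear_blocks[OF lin])
  show "bij Q" by (rule bij_Q)
  have "flag_act g (graph_flag X) = graph_flag (N \<circ> inv Q)"
    using bij_is_surj[OF bij_if_SL_block[OF U(2)]]
    by (simp add: flag_act_def graph_flag_def image_image gX range_frame hlinear_0[OF lin])
  then show "flag_act g (graph_flag X) \<in> flag_domain"
      "graph_map (flag_act g (graph_flag X)) = N \<circ> inv Q"
    using slope_in_matrix_domain[OF fin] by (simp_all add: graph_flag_in_flag_domain)
qed

section \<open>Topology\<close>

lemma topspace_direct_limit_topology: "topspace (direct_limit_topology \<A>) = \<Union>(topspace ` \<A>)"
proof
  show "topspace (direct_limit_topology \<A>) \<subseteq> \<Union>(topspace ` \<A>)"
    using openin_topspace[of "direct_limit_topology \<A>"] unfolding openin_direct_limit_topology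
    by (rule conjunct1)
  have "\<Union>(topspace ` \<A>) \<inter> topspace T = topspace T" if "T \<in> \<A>" for T using that by blast
  then have "openin (direct_limit_topology \<A>) (\<Union>(topspace ` \<A>))"
    by (simp add: openin_direct_limit_topology)
  then show "\<Union>(topspace ` \<A>) \<subseteq> topspace (direct_limit_topology \<A>)" by (rule openin_subset)
qed

lemma continuous_map_into_direct_limit:
  assumes "T \<in> \<A>" "continuous_map X T f"
  shows "continuous_map X (direct_limit_topology \<A>) f"
  unfolding continuous_map_def topspace_direct_limit_topology
proof (intro conjI allI impI)
  have f: "f x \<in> topspace T" if "x \<in> topspace X" for x
    using assms(2) that by (auto simp: continuous_map_def)
  then show "f \<in> topspace X \<rightarrow> \<Union>(topspace ` \<A>)" using assms(1) by auto
  fix U assume "openin (direct_limit_topology \<A>) U"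
  then have "openin T (U \<inter> topspace T)" using assms(1) by (simp add: openin_direct_limit_topology)
  from openin_continuous_map_preimage[OF assms(2) this] f
  show "openin X {x \<in> topspace X. f x \<in> U}" by (simp cong: conj_cong)
qed

lemma continuous_map_from_direct_limit:
  assumes "\<And>T. T \<in> \<A> \<Longrightarrow> continuous_map T Y f"
  shows "continuous_map (direct_limit_topology \<A>) Y f"
  unfolding continuous_map_def topspace_direct_limit_topology openin_direct_limit_topology
proof (intro conjI allI impI ballI)
  show "f \<in> \<Union>(topspace ` \<A>) \<rightarrow> topspace Y" using assms by (fastforce simp: continuous_map_def)
  fix U T assume "openin Y U" "T \<in> \<A>"
  have "{x \<in> \<Union>(topspace ` \<A>). f x \<in> U} \<inter> topspace T = {x \<in> topspace T. f x \<in> U}"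
    using \<open>T \<in> \<A>\<close> by auto
  then show "openin T ({x \<in> \<Union>(topspace ` \<A>). f x \<in> U} \<inter> topspace T)"
    using openin_continuous_map_preimage[OF assms[OF \<open>T \<in> \<A>\<close>] \<open>openin Y U\<close>] by simp
qed auto

lemma topspace_image_quotient_topology: "topspace (image_quotient_topology T f) = f ` topspace T"
proof
  show "topspace (image_quotient_topology T f) \<subseteq> f ` topspace T"
    using openin_topspace[of "image_quotient_topology T f"]
    unfolding openin_image_quotient_topology by (rule conjunct1)
  have "{x \<in> topspace T. f x \<in> f ` topspace T} = topspace T" by blast
  then have "openin (image_quotient_topology T f) (f ` topspace T)"
    by (simp add: openin_image_quotient_topology)
  then show "f ` topspace T \<subseteq> topspace (image_quotient_topology T f)" by (rule openin_subset)
qed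

lemma continuous_map_image_quotient: "continuous_map T (image_quotient_topology T f) f"
  by (auto simp: continuous_map_def topspace_image_quotient_topology openin_image_quotient_topology)

text \<open>The spaces of maps carry topologies given as values, not through a type class. In this
  pointwise form the usual \<open>tendsto\<close> rules for sums, products and norms become
  applicable to functions on them.\<close>

lemma continuous_map_euclidean_iff:
  "continuous_map X euclidean f \<longleftrightarrow> (\<forall>x\<in>topspace X. (f \<longlongrightarrow> f x) (atin X x))"
  by (simp add: continuous_map_atin)

lemma continuous_map_into_coordinate_pullback:
  fixes e :: "'a \<Rightarrow> 'k \<Rightarrow> 'c::topological_space"
  assumes "\<And>k. continuous_map X euclidean (\<lambda>x. e (f x) k)" "\<And>x. x \<in> topspace X \<Longrightarrow> f x \<in> A"
  shows "continuous_map X (pullback_topology A e euclidean) f"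
proof (rule continuous_map_pullback')
  show "continuous_map X euclidean (e \<circ> f)"
    using assms(1)
    by (simp add: continuous_map_componentwise_UNIV flip: euclidean_product_topology)
qed (use assms(2) in auto)

lemma continuous_map_coordinate:
  fixes e :: "'a \<Rightarrow> 'k \<Rightarrow> 'c::topological_space"
  shows "continuous_map (pullback_topology A e euclidean) euclidean (\<lambda>x. e x k)"
proof -
  have "continuous_map euclidean euclidean (\<lambda>z :: 'k \<Rightarrow> 'c. z k)"
    unfolding euclidean_product_topology[symmetric]
    by (rule continuous_map_product_projection) simp
  from continuous_map_pullback[OF this] show ?thesis by (simp add: comp_def)
qed

section \<open>Topologies of the finite blocks\<close>

definition block_topology :: "'i set \<Rightarrow> 'j set \<Rightarrow> (('j \<Rightarrow>\<^sub>0 quat) \<Rightarrow> ('i \<Rightarrow>\<^sub>0 quat)) topology"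
  where "block_topology S T =
    pullback_topology (finitary_block S T) (\<lambda>X (i, j). entry X i j) euclidean"

definition SL_block_topology :: "(nat + 'q) set \<Rightarrow> ('q hspace \<Rightarrow> 'q hspace) topology"
  where "SL_block_topology U = pullback_topology (SL_block U) (\<lambda>g (k, l). gentry g k l) euclidean"

lemma topspace_block_topology [simp]: "topspace (block_topology S T) = finitary_block S T"
  by (simp add: block_topology_def topspace_pullback_topology)

lemma topspace_SL_block_topology [simp]: "topspace (SL_block_topology U) = SL_block U"
  by (simp add: SL_block_topology_def topspace_pullback_topology)

lemma finitary_topology_eq:
  "finitary_topology = direct_limit_topology {block_topology S T | S T. finite S \<and> finite T}"
  by (simp add: finitary_topology_def block_topology_def)

lemma SL_inf_topology_eq: "SL_inf_topology = direct_limit_topology {SL_block_topology U | U. finite U}"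
  by (simp add: SL_inf_topology_def SL_block_topology_def)

lemma topspace_finitary_topology: "topspace finitary_topology = {X. finitary X}"
  unfolding finitary_topology_eq topspace_direct_limit_topology
  by (auto intro: finitary_if_finitary_block elim!: finitary_imp_finitary_block)
    (metis (mono_tags, lifting) finitary_imp_finitary_block topspace_block_topology)

lemma topspace_SL_inf_topology: "topspace SL_inf_topology = SL_inf"
  unfolding SL_inf_topology_eq topspace_direct_limit_topology SL_inf_def by fastforce

lemma topspace_flag_topology: "topspace flag_topology = flag_manifold"
  by (simp add: flag_topology_def topspace_image_quotient_topology topspace_SL_inf_topology
      flag_manifold_def)

text \<open>The quotient and the direct limit are both final topologies, and final topologies
  compose. A set of flags is therefore tested on representing group elements, one finite block at a
  time, where matrix entries are continuous coordinates.\<close>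

lemma openin_flag_topology_iff:
  fixes W :: "'q hflag set"
  shows "openin flag_topology W \<longleftrightarrow> W \<subseteq> flag_manifold \<and>
    (\<forall>U. finite U \<longrightarrow> openin (SL_block_topology U) {g \<in> SL_block U. flag_act g base_flag \<in> W})"
proof -
  have "{g \<in> SL_inf. flag_act g base_flag \<in> W} \<inter> SL_block U = {g \<in> SL_block U. flag_act g base_flag \<in> W}"
    if "finite U" for U :: "(nat + 'q) set"
    using that by (auto simp: SL_inf_def)
  moreover have "(SL_inf :: ('q hspace \<Rightarrow> 'q hspace) set) =
      \<Union> (topspace ` {SL_block_topology U | U. finite U})"
    by (simp only: topspace_SL_inf_topology[symmetric] SL_inf_topology_eq
        topspace_direct_limit_topology)
  ultimately show ?thesis
    unfolding flag_topology_def openin_image_quotient_topology topspace_SL_inf_topology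
      flag_manifold_def[symmetric]
    by (auto simp: SL_inf_topology_eq openin_direct_limit_topology)
qed

lemma continuous_map_entry: "continuous_map (block_topology S T) euclidean (\<lambda>X. entry X i j)"
  using continuous_map_coordinate[of "finitary_block S T" "\<lambda>X (i, j). entry X i j" "(i, j)"]
  by (simp add: block_topology_def)

lemma continuous_map_gentry: "continuous_map (SL_block_topology U) euclidean (\<lambda>g. gentry g k l)"
  using continuous_map_coordinate[of "SL_block U" "\<lambda>g (k, l). gentry g k l" "(k, l)"]
  by (simp add: SL_block_topology_def)

lemma continuous_map_into_block_topology:
  assumes "\<And>i j. continuous_map Y euclidean (\<lambda>x. entry (f x) i j)"
    "\<And>x. x \<in> topspace Y \<Longrightarrow> f x \<in> finitary_block S T"
  shows "continuous_map Y (block_topology S T) f"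
  unfolding block_topology_def using assms
  by (intro continuous_map_into_coordinate_pullback) (auto simp: case_prod_beta)

lemma continuous_map_into_finitary_topology:
  "finite S \<Longrightarrow> finite T \<Longrightarrow> continuous_map Y (block_topology S T) f \<Longrightarrow>
    continuous_map Y finitary_topology f"
  unfolding finitary_topology_eq by (rule continuous_map_into_direct_limit) auto

lemma continuous_map_shear:
  fixes T :: "'q set"
  assumes "finite S" "finite T"
  shows "continuous_map (block_topology S T) (SL_block_topology (S <+> T)) shear"
  unfolding SL_block_topology_def
proof (rule continuous_map_into_coordinate_pullback)
  fix kl :: "(nat + 'q) \<times> (nat + 'q)"
  obtain k l where kl: "kl = (k, l)" by (cases kl)
  have lin: "hlinear X" if "X \<in> topspace (block_topology S T)" for X :: "'q hminus \<Rightarrow> hplus"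
    using that by (simp add: hlinear_if_finitary_block)
  have "continuous_map (block_topology S T) euclidean (\<lambda>X. gentry (shear X) k l)"
  proof (cases "\<exists>i j. k = Inl i \<and> l = Inr j")
    case True
    then show ?thesis
      by (auto intro: continuous_map_eq[OF continuous_map_entry] simp: gentry_shear lin)
  next
    case False
    then have "(if k = l then 1 else 0) = gentry (shear X) k l"
      if "X \<in> topspace (block_topology S T)" for X
      by (cases k; cases l) (simp_all add: gentry_shear[OF lin[OF that]])
    with continuous_map_const[THEN iffD2] show ?thesis
      by (rule continuous_map_eq) simp
  qed
  then show "continuous_map (block_topology S T) euclidean (\<lambda>X. case kl of (k, l) \<Rightarrow> gentry (shear X) k l)"
    by (simp add: kl)
qed (simp add: shear_in_SL_block assms)

lemma continuous_map_graph_flag: "continuous_map finitary_topology flag_topology graph_flag"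
  unfolding finitary_topology_eq
proof (rule continuous_map_from_direct_limit)
  fix Z :: "('q hminus \<Rightarrow> hplus) topology"
  assume "Z \<in> {block_topology S T | S T. finite S \<and> finite T}"
  then obtain S T where Z: "Z = block_topology S T" "finite S" "finite T" by blast
  have "continuous_map Z SL_inf_topology shear"
    unfolding SL_inf_topology_eq Z(1)
    by (rule continuous_map_into_direct_limit[OF _ continuous_map_shear[OF Z(2,3)]]) (use Z in auto)
  moreover have "continuous_map SL_inf_topology flag_topology (\<lambda>g. flag_act g base_flag)"
    unfolding flag_topology_def by (rule continuous_map_image_quotient)
  ultimately have "continuous_map Z flag_topology ((\<lambda>g. flag_act g base_flag) \<circ> shear)"
    by (rule continuous_map_compose)
  then show "continuous_map Z flag_topology graph_flag"
    by (rule continuous_map_eq)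
      (use Z in \<open>auto intro!: flag_act_shear finitary_if_finitary_block\<close>)
qed

section \<open>Openness of the flag domain by compactness\<close>

lemma compact_quat_cball: "compact (cball (0 :: quat) 1)"
proof -
  \<comment> \<open>The map is the isometry \<open>Quat\<close> from real 4-space, written as a
    linear combination so that its continuity is visible.\<close>
  let ?f = "\<lambda>(a, b, c, d). a *\<^sub>R Quat 1 0 0 0 + b *\<^sub>R Quat 0 1 0 0 + c *\<^sub>R Quat 0 0 1 0 + d *\<^sub>R Quat 0 0 0 1"
  have f: "a *\<^sub>R Quat 1 0 0 0 + b *\<^sub>R Quat 0 1 0 0 + c *\<^sub>R Quat 0 0 1 0 + d *\<^sub>R Quat 0 0 0 1 =
      Quat a b c d" for a b c d
    by (simp add: plus_quat_def scaleR_quat_def)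
  have n: "norm (Quat a b c d) = norm (a, b, c, d)" for a b c d
    by (simp add: norm_quat_def qnorm2_def norm_prod_def)
  have "cball 0 1 = ?f ` cball 0 1"
  proof (intro equalityI subsetI)
    fix x :: quat assume "x \<in> cball 0 1"
    then show "x \<in> ?f ` cball 0 1"
      using n[of "qre x" "qi x" "qj x" "qk x"]
      by (intro image_eqI[of _ _ "(qre x, qi x, qj x, qk x)"]) (simp_all add: f)
  qed (auto simp: f n)
  moreover have "compact (?f ` cball 0 1)"
    unfolding case_prod_beta by (intro compact_continuous_image continuous_intros) simp
  ultimately show ?thesis by simp
qed

text \<open>Encoded by functions that vanish off \<open>T\<close> instead of
  \<open>poly_mapping\<close> vectors, so that it is a closed part of a product of compact sets in
  the function space and Tychonoff's theorem gives compactness.\<close>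

definition coordinate_sphere :: "'j set \<Rightarrow> ('j \<Rightarrow> quat) set"
  where "coordinate_sphere T = {y. (\<forall>j. j \<notin> T \<longrightarrow> y j = 0) \<and> (\<Sum>j\<in>T. (norm (y j))\<^sup>2) = 1}"

lemma compact_coordinate_sphere:
  assumes "finite T"
  shows "compact (coordinate_sphere T)"
proof -
  let ?B = "\<lambda>j. if j \<in> T then cball 0 1 else {0 :: quat}"
  have "compactin (product_topology (\<lambda>_. euclidean) UNIV) (Pi\<^sub>E UNIV ?B)"
    by (auto simp: compactin_PiE compact_quat_cball)
  then have "compact (Pi\<^sub>E UNIV ?B)" by (simp add: euclidean_product_topology)
  moreover have "closed {y :: 'a \<Rightarrow> quat. (\<Sum>j\<in>T. (norm (y j))\<^sup>2) = 1}"
    by (intro closed_Collect_eq continuous_intros continuous_on_product_coordinates)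
  moreover have "coordinate_sphere T = Pi\<^sub>E UNIV ?B \<inter> {y. (\<Sum>j\<in>T. (norm (y j))\<^sup>2) = 1}"
  proof -
    have "norm (y j) \<le> 1" if "(\<Sum>j\<in>T. (norm (y j))\<^sup>2) = 1" "j \<in> T" for y :: "'a \<Rightarrow> quat" and j
      using member_le_sum[of j T "\<lambda>j. (norm (y j))\<^sup>2"] that assms
      by (simp add: abs_square_le_1)
    then show ?thesis by (auto simp: coordinate_sphere_def PiE_iff split: if_splits)
  qed
  ultimately show ?thesis by (simp add: compact_Int_closed)
qed

text \<open>For \<open>y\<close> supported on the negative indices of \<open>U\<close> this is the
  negative of the form at \<open>g (0, y)\<close>. Writing it through the entries of
  \<open>g\<close> makes it jointly continuous in \<open>g\<close> and \<open>y\<close>.\<close>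

definition defect :: "(nat + 'q) set \<Rightarrow> ('q hspace \<Rightarrow> 'q hspace) \<Rightarrow> ('q \<Rightarrow> quat) \<Rightarrow> real"
  where "defect U g y =
    (\<Sum>t\<in>Inr -` U. (norm (\<Sum>j\<in>Inr -` U. gentry g (Inr t) (Inr j) * y j))\<^sup>2) -
    (\<Sum>i\<in>Inl -` U. (norm (\<Sum>j\<in>Inr -` U. gentry g (Inl i) (Inr j) * y j))\<^sup>2)"

text \<open>Coordinates of \<open>y\<close> outside the block are left alone by \<open>D\<close> and
  annihilated by \<open>B\<close>, so they contribute just their own squares.\<close>

lemma hnorm_blocks_eq_defect:
  assumes g: "g \<in> SL_block U" and U: "finite U"
  shows "(hnorm (block_D g y))\<^sup>2 - (hnorm (block_B g y))\<^sup>2 =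
    defect U g (lk y) + (\<Sum>j\<in>Poly_Mapping.keys y - Inr -` U. (norm (lk y j))\<^sup>2)"
proof -
  let ?S = "Inl -` U" and ?T = "Inr -` U"
  have fin: "finite ?S" "finite ?T" using U by (simp_all add: finite_vimageI)
  note lin = hlinear_blocks[OF hlinear_if_SL_block[OF g]]
  have col: "gentry g k (Inr j) = (if k = Inr j then 1 else 0)" if "j \<notin> ?T" for k j
    using SL_block_vbasis[OF g, of "Inr j"] that by (simp add: gentry_def coord_vbasis del: vbasis.simps)
  have expand: "(\<Sum>j\<in>?T \<union> Poly_Mapping.keys y. gentry g k (Inr j) * lk y j) =
      (\<Sum>j\<in>?T. gentry g k (Inr j) * lk y j)" if "k \<in> U" for k
    using fin that by (intro sum.mono_neutral_right) (auto simp: col)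
  have B: "lk (block_B g y) i = (\<Sum>j\<in>?T. gentry g (Inl i) (Inr j) * lk y j)" if "i \<in> ?S" for i
    using that expand[of "Inl i"] fin
    by (subst lk_hlinear[OF lin(2), of "?T \<union> Poly_Mapping.keys y"]) (auto simp: entry_blocks)
  have D: "lk (block_D g y) t = (\<Sum>j\<in>?T. gentry g (Inr t) (Inr j) * lk y j)" if "t \<in> ?T" for t
    using that expand[of "Inr t"] fin
    by (subst lk_hlinear[OF lin(4), of "?T \<union> Poly_Mapping.keys y"]) (auto simp: entry_blocks)
  have D': "lk (block_D g y) t = lk y t" if "t \<notin> ?T" for t
    using that by (simp add: blocks_outside_row[OF g])
  have kB: "Poly_Mapping.keys (block_B g y) \<subseteq> ?S"
    using blocks_outside_row(2)[OF g] by (force simp: in_keys_iff)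
  have kD: "Poly_Mapping.keys (block_D g y) \<subseteq> ?T \<union> (Poly_Mapping.keys y - ?T)"
    using D' by (force simp: in_keys_iff)
  have "(hnorm (block_D g y))\<^sup>2 = (\<Sum>t\<in>?T \<union> (Poly_Mapping.keys y - ?T). (norm (lk (block_D g y) t))\<^sup>2)"
    using fin kD by (subst hnorm_eq_L2_set[OF _ kD]) (simp_all add: L2_set_def sum_nonneg)
  also have "\<dots> = (\<Sum>t\<in>?T. (norm (lk (block_D g y) t))\<^sup>2) +
      (\<Sum>t\<in>Poly_Mapping.keys y - ?T. (norm (lk (block_D g y) t))\<^sup>2)"
    using fin by (intro sum.union_disjoint) auto
  finally have "(hnorm (block_D g y))\<^sup>2 =
      (\<Sum>t\<in>?T. (norm (\<Sum>j\<in>?T. gentry g (Inr t) (Inr j) * lk y j))\<^sup>2) +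
      (\<Sum>j\<in>Poly_Mapping.keys y - ?T. (norm (lk y j))\<^sup>2)"
    by (simp add: D D')
  moreover have "(hnorm (block_B g y))\<^sup>2 =
      (\<Sum>i\<in>?S. (norm (\<Sum>j\<in>?T. gentry g (Inl i) (Inr j) * lk y j))\<^sup>2)"
    by (subst hnorm_eq_L2_set[OF fin(1) kB]) (simp add: L2_set_def sum_nonneg B)
  ultimately show ?thesis by (simp add: defect_def)
qed

lemma defect_scale: "defect U g (\<lambda>j. y j * of_real r) = r\<^sup>2 * defect U g y"
  by (simp add: defect_def norm_mult power_mult_distrib right_diff_distrib sum_distrib_left mult.commute
      flip: sum_distrib_right mult.assoc)

text \<open>The outside coordinates can only help, so negative definiteness is decided by
  \<open>defect\<close> on the finite block, and by homogeneity already on its unit sphere.\<close>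

lemma flag_act_base_flag_in_flag_domain_iff_defect:
  assumes g: "g \<in> SL_block U" and U: "finite U"
  shows "flag_act g base_flag \<in> flag_domain \<longleftrightarrow> (\<forall>y\<in>coordinate_sphere (Inr -` U). 0 < defect U g y)"
proof -
  let ?T = "Inr -` U"
  have fin: "finite ?T" using U by (simp add: finite_vimageI)
  have lt: "hnorm (block_B g y) < hnorm (block_D g y) \<longleftrightarrow>
      0 < defect U g (lk y) + (\<Sum>j\<in>Poly_Mapping.keys y - ?T. (norm (lk y j))\<^sup>2)" for y
    unfolding hnorm_blocks_eq_defect[OF assms, symmetric]
    using power_mono_iff[of "hnorm (block_D g y)" "hnorm (block_B g y)" 2]
    by (simp add: not_le[symmetric])
  show ?thesis unfolding flag_act_base_flag_in_flag_domain_iff[OF assms]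
  proof (intro iffI ballI allI impI)
    fix y assume neg: "\<forall>y. y \<noteq> 0 \<longrightarrow> hnorm (block_B g y) < hnorm (block_D g y)"
      and y: "y \<in> coordinate_sphere ?T"
    have "{j. y j \<noteq> 0} \<subseteq> ?T" using y by (auto simp: coordinate_sphere_def)
    then have "finite {j. y j \<noteq> 0}" using fin by (rule finite_subset)
    then have lk: "lk (Abs_poly_mapping y) = y" by simp
    have "Abs_poly_mapping y \<noteq> 0"
    proof
      assume "Abs_poly_mapping y = 0"
      with lk have "y = (\<lambda>_. 0)" by auto
      with y show False by (simp add: coordinate_sphere_def)
    qed
    moreover have "Poly_Mapping.keys (Abs_poly_mapping y) - ?T = {}"
      using y by (auto simp: in_keys_iff lk coordinate_sphere_def)
    ultimately have "0 < defect U g y + (\<Sum>j\<in>{}. (norm (y j))\<^sup>2)"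
      using neg lt[of "Abs_poly_mapping y"] by (metis lk)
    then show "0 < defect U g y" by simp
  next
    fix y :: "'a hminus"
    assume pos: "\<forall>y\<in>coordinate_sphere ?T. 0 < defect U g y" and y: "y \<noteq> 0"
    define n where "n = (\<Sum>j\<in>?T. (norm (lk y j))\<^sup>2)"
    define z where "z = (\<lambda>j. if j \<in> ?T then lk y j else 0)"
    have dz: "defect U g (lk y) = defect U g z" by (simp add: defect_def z_def)
    show "hnorm (block_B g y) < hnorm (block_D g y)"
    proof (cases "n = 0")
      \<comment> \<open>Here \<open>y\<close> vanishes on the block and the outside squares alone
        are positive. An empty block, whose sphere is empty, falls under this case.\<close>
      case True
      then have z0: "lk y j = 0" if "j \<in> ?T" for j
        using that fin by (auto simp: n_def sum_nonneg_eq_0_iff)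
      then have "z = (\<lambda>_. 0)" by (auto simp: z_def)
      then have "defect U g (lk y) = 0" unfolding dz by (simp add: defect_def)
      moreover obtain j where "j \<in> Poly_Mapping.keys y" using y by (metis keys_eq_empty ex_in_conv)
      then have "0 < (\<Sum>j\<in>Poly_Mapping.keys y - ?T. (norm (lk y j))\<^sup>2)"
        using z0 by (intro sum_pos2[of _ j]) (auto simp: in_keys_iff)
      ultimately show ?thesis by (simp add: lt)
    next
      case False
      then have n: "0 < n" by (simp add: n_def sum_nonneg order.not_eq_order_implies_strict)
      define r where "r = inverse (sqrt n)"
      have r: "r\<^sup>2 * n = 1" "0 < r\<^sup>2" using n by (simp_all add: r_def power_inverse)
      have "(\<Sum>j\<in>?T. (norm (z j * of_real r))\<^sup>2) = r\<^sup>2 * n"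
        by (simp add: n_def z_def norm_mult power_mult_distrib sum_distrib_left mult.commute)
      then have "(\<lambda>j. z j * of_real r) \<in> coordinate_sphere ?T"
        using r by (auto simp: coordinate_sphere_def z_def)
      with pos have "0 < r\<^sup>2 * defect U g z" by (metis defect_scale)
      with r have "0 < defect U g (lk y)" by (simp add: dz zero_less_mult_iff)
      then show ?thesis by (simp add: lt add_pos_nonneg sum_nonneg)
    qed
  qed
qed

text \<open>The group elements to be excluded form the projection of the closed set where
  \<open>defect\<close> is at most 0 in the product of the block with the sphere; projection along a
  compact factor is a closed map.\<close>

lemma openin_flag_domain_SL_block:
  fixes U :: "(nat + 'q) set"
  assumes "finite U"
  shows "openin (SL_block_topology U) {g \<in> SL_block U. flag_act g base_flag \<in> flag_domain}"
proof -
  let ?K = "coordinate_sphere (Inr -` U :: 'q set)"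
  let ?P = "prod_topology (SL_block_topology U) (top_of_set ?K)"
  have K: "compact_space (top_of_set ?K)"
    using assms by (simp add: compact_coordinate_sphere finite_vimageI compact_space_subtopology)
  have "continuous_map ?P euclidean (\<lambda>(g, y). defect U g y)"
    unfolding continuous_map_euclidean_iff
  proof
    fix p assume p: "p \<in> topspace ?P"
    have g: "((\<lambda>p. gentry (fst p) k l) \<longlongrightarrow> gentry (fst p) k l) (atin ?P p)" for k l
    proof -
      have "continuous_map ?P euclidean (\<lambda>p. gentry (fst p) k l)"
        using continuous_map_compose[OF continuous_map_fst continuous_map_gentry]
        by (simp only: comp_def)
      then show ?thesis using p unfolding continuous_map_euclidean_iff by blast
    qed
    have "continuous_map (top_of_set ?K) euclidean (\<lambda>y. y j)" for j
      using continuous_on_subset[OF continuous_on_product_coordinates subset_UNIV, of ?K] by simp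
    from continuous_map_compose[OF continuous_map_snd this]
    have "continuous_map ?P euclidean (\<lambda>p. snd p j)" for j
      by (simp only: comp_def)
    then have y: "((\<lambda>p. snd p j) \<longlongrightarrow> snd p j) (atin ?P p)" for j
      using p unfolding continuous_map_euclidean_iff by blast
    show "((\<lambda>(g, y). defect U g y) \<longlongrightarrow> (case p of (g, y) \<Rightarrow> defect U g y)) (atin ?P p)"
      unfolding case_prod_beta defect_def by (intro tendsto_intros g y)
  qed
  then have "closedin ?P {p \<in> topspace ?P. (case p of (g, y) \<Rightarrow> defect U g y) \<in> {..0}}"
    by (rule closedin_continuous_map_preimage) simp
  then have "closedin (SL_block_topology U)
      (fst ` {p \<in> topspace ?P. (case p of (g, y) \<Rightarrow> defect U g y) \<in> {..0}})" (is "closedin _ ?C")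
    using closed_map_fst[OF K] unfolding closed_map_def by blast
  from openin_diff[OF openin_topspace this]
  have "openin (SL_block_topology U) (SL_block U - ?C)"
    by (simp only: topspace_SL_block_topology)
  moreover have "{g \<in> SL_block U. flag_act g base_flag \<in> flag_domain} = SL_block U - ?C"
  proof -
    have "g \<in> ?C \<longleftrightarrow> (\<exists>y\<in>?K. \<not> 0 < defect U g y)" if "g \<in> SL_block U" for g
      unfolding image_iff Bex_def using that by (simp add: not_less) blast
    then show ?thesis using flag_act_base_flag_in_flag_domain_iff_defect[OF _ assms] by blast
  qed
  ultimately show ?thesis by (simp only:)
qed

lemma openin_flag_domain: "openin flag_topology flag_domain"
  unfolding openin_flag_topology_iff
  by (auto simp: openin_flag_domain_SL_block) (auto simp: flag_domain_def)

text \<open>Writing \<open>X\<^sub>g\<close> for the map of the flag of \<open>g\<close>, the identity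
  \<open>X\<^sub>g (D\<^sub>0 y) = B\<^sub>g y - X\<^sub>g (D\<^sub>g y - D\<^sub>0 y)\<close> and the bound \<open>\<parallel>X\<^sub>g\<parallel> \<le> 1\<close> give continuity
  at \<open>g\<^sub>0\<close> without inverting \<open>D\<^sub>g\<close>.\<close>

lemma continuous_map_graph_map_SL_block:
  assumes U: "finite U"
  shows "continuous_map
    (subtopology (SL_block_topology U) {g. flag_act g base_flag \<in> (flag_domain :: 'q hflag set)})
    (block_topology (Inl -` U) (Inr -` U)) (\<lambda>g. graph_map (flag_act g base_flag))"
    (is "continuous_map ?Z _ ?X")
proof (rule continuous_map_into_block_topology)
  let ?T = "Inr -` U :: 'q set"
  have fin: "finite ?T" using U by (simp add: finite_vimageI)
  have X: "?X g \<in> finitary_block (Inl -` U) ?T" "?X g \<in> matrix_domain"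
      "?X g (block_D g y) = block_B g y" "\<exists>y. block_D g y = z"
    if "g \<in> topspace ?Z" for g y z
  proof -
    have g: "g \<in> SL_block U" and d: "flag_act g base_flag \<in> flag_domain"
      using that by simp_all
    have neg: "neg_definite (range (\<lambda>y. (block_B g y, block_D g y)))"
      using d by (simp add: flag_domain_def flag_act_base_flag[OF g] max_neg_definite_def)
    interpret negative_frame "Inl -` U" ?T "block_B g" "block_D g"
      by (rule negative_frame_SL_block[OF g U neg])
    have "?X g = block_B g \<circ> inv (block_D g)"
      by (simp add: flag_act_base_flag_in_flag_domain(1)[OF g U neg])
    then show "?X g \<in> finitary_block (Inl -` U) ?T" "?X g \<in> matrix_domain"
      "?X g (block_D g y) = block_B g y"
      using flag_act_base_flag_in_flag_domain(2)[OF g U neg] by simp_all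
    show "\<exists>y. block_D g y = z" using Q_inv by blast
  qed
  then show "?X g \<in> finitary_block (Inl -` U) ?T" if "g \<in> topspace ?Z" for g using that by blast
  fix i j
  show "continuous_map ?Z euclidean (\<lambda>g. entry (?X g) i j)"
    unfolding continuous_map_euclidean_iff
  proof
    fix g0 assume g0: "g0 \<in> topspace ?Z"
    \<comment> \<open>The preimage of \<open>bv j\<close> is taken at \<open>g0\<close> and kept
      fixed, so that only \<open>block_B g y\<close> and \<open>block_D g y\<close> move with
      \<open>g\<close>.\<close>
    obtain y where y: "block_D g0 y = bv j" using X(4)[OF g0] by blast
    have SL: "g \<in> SL_block U" if "g \<in> topspace ?Z" for g using that by simp
    have blk: "lk (block_B g y) i = (\<Sum>j\<in>Poly_Mapping.keys y. gentry g (Inl i) (Inr j) * lk y j)"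
      "lk (block_D g y) t = (\<Sum>j\<in>Poly_Mapping.keys y. gentry g (Inr t) (Inr j) * lk y j)"
      if "g \<in> topspace ?Z" for g i t
      by (simp_all add: lk_hlinear[OF _ finite_keys order_refl] entry_blocks
          hlinear_blocks[OF hlinear_if_SL_block[OF SL[OF that]]])
    \<comment> \<open>Off \<open>?T\<close> the rows of \<open>block_D g\<close> and
      \<open>block_D g0\<close> agree, so the norm of the difference is an \<open>L2_set\<close>
      over \<open>?T\<close>. Thus \<open>r\<close> depends on finitely many entries of
      \<open>g\<close>, and it vanishes at \<open>g0\<close>.\<close>
    define r where "r = (\<lambda>g.
      L2_set (\<lambda>t. norm (lk (block_D g0 y) t -
        (\<Sum>j\<in>Poly_Mapping.keys y. gentry g (Inr t) (Inr j) * lk y j))) ?T +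
      norm ((\<Sum>j\<in>Poly_Mapping.keys y. gentry g (Inl i) (Inr j) * lk y j) - lk (block_B g0 y) i))"
    have "norm (entry (?X g) i j - entry (?X g0) i j) \<le> r g" if g: "g \<in> topspace ?Z" for g
    proof -
      let ?d = "block_D g0 y - block_D g y"
      have lin: "hlinear (?X g)" by (rule hlinear_if_finitary_block[OF X(1)[OF g]])
      have "?X g (bv j) = ?X g ?d + block_B g y"
        using hlinear_add[OF lin, of ?d "block_D g y"] X(3)[OF g] by (simp add: y)
      moreover have "?X g0 (bv j) = block_B g0 y" using X(3)[OF g0] by (simp flip: y)
      ultimately have "entry (?X g) i j - entry (?X g0) i j =
          lk (?X g ?d) i + (lk (block_B g y) i - lk (block_B g0 y) i)"
        by (simp add: entry_def lookup_add)
      also have "norm \<dots> \<le> norm (lk (?X g ?d) i) + norm (lk (block_B g y) i - lk (block_B g0 y) i)"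
        by (rule norm_triangle_ineq)
      also have "norm (lk (?X g ?d) i) \<le> hnorm ?d"
      proof (cases "?d = 0")
        case True
        then show ?thesis by (simp add: hlinear_0[OF lin])
      next
        case False
        then have "hnorm (?X g ?d) < hnorm ?d" using X(2)[OF g] unfolding matrix_domain_iff by blast
        then show ?thesis using norm_lk_le_hnorm[of "?X g ?d" i] by linarith
      qed
      also have "hnorm ?d = L2_set (\<lambda>t. norm (lk ?d t)) ?T"
        using blocks_outside_row(4)[OF SL[OF g]] blocks_outside_row(4)[OF SL[OF g0]]
        by (intro hnorm_eq_L2_set[OF fin]) (force simp: in_keys_iff lookup_minus)
      finally show ?thesis
        unfolding r_def using blk(1)[OF g, of i] blk(2)[OF g] by (simp add: lookup_minus)
    qed
    then have "eventually (\<lambda>g. norm (entry (?X g) i j - entry (?X g0) i j) \<le> r g) (atin ?Z g0)"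
      unfolding eventually_atin using g0 by (metis DiffD1 openin_topspace)
    moreover have "(r \<longlongrightarrow> 0) (atin ?Z g0)"
    proof -
      have "continuous_map ?Z euclidean (\<lambda>g. gentry g k l)" for k l
        by (rule continuous_map_from_subtopology[OF continuous_map_gentry])
      then have *: "((\<lambda>g. gentry g k l) \<longlongrightarrow> gentry g0 k l) (atin ?Z g0)" for k l
        using g0 unfolding continuous_map_euclidean_iff by blast
      have "(r \<longlongrightarrow> r g0) (atin ?Z g0)"
        unfolding r_def L2_set_def by (intro tendsto_intros *)
      moreover have "r g0 = 0"
        using blk[OF g0] by (simp add: r_def L2_set_def)
      ultimately show ?thesis by simp
    qed
    ultimately have "((\<lambda>g. entry (?X g) i j - entry (?X g0) i j) \<longlongrightarrow> 0) (atin ?Z g0)"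
      by (rule Lim_null_comparison)
    then show "((\<lambda>g. entry (?X g) i j) \<longlongrightarrow> entry (?X g0) i j) (atin ?Z g0)"
      by (simp add: LIM_zero_iff)
  qed
qed

text \<open>A quotient map need not stay one over a subspace, but over the open
  \<open>flag_domain\<close> it does: relatively open sets are open in the whole flag manifold and
  can be tested on blocks. Inside each block the same passage uses that the preimage of the domain
  is open.\<close>

lemma continuous_map_graph_map:
  "continuous_map (subtopology flag_topology flag_domain) finitary_topology graph_map"
  unfolding continuous_map_def
proof (intro conjI allI impI)
  have sub: "flag_domain \<subseteq> flag_manifold" by (auto simp: flag_domain_def)
  then have tops: "topspace (subtopology flag_topology flag_domain) = flag_domain"
    by (auto simp: topspace_flag_topology)
  show "graph_map \<in> topspace (subtopology flag_topology flag_domain) \<rightarrow> topspace finitary_topology"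
    unfolding tops topspace_finitary_topology flag_domain_eq
    by (auto simp: matrix_domain_iff)
  fix V :: "('a hminus \<Rightarrow> hplus) set" assume V: "openin finitary_topology V"
  let ?W = "{F \<in> flag_domain. graph_map F \<in> V}"
  have "openin (SL_block_topology U) {g \<in> SL_block U. flag_act g base_flag \<in> ?W}"
    if U: "finite U" for U :: "(nat + 'a) set"
  proof -
    let ?D = "{g. flag_act g base_flag \<in> (flag_domain :: 'a hflag set)}"
    let ?Z = "subtopology (SL_block_topology U) ?D"
    have "continuous_map ?Z finitary_topology (\<lambda>g. graph_map (flag_act g base_flag))"
      by (rule continuous_map_into_finitary_topology[OF _ _ continuous_map_graph_map_SL_block[OF U]])
        (simp_all add: U finite_vimageI)
    from openin_continuous_map_preimage[OF this V]
    have o: "openin ?Z {g \<in> SL_block U. flag_act g base_flag \<in> ?W}"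
      by (simp add: Collect_conj_eq Int_ac)
    have "?Z = subtopology (SL_block_topology U) {g \<in> SL_block U. flag_act g base_flag \<in> flag_domain}"
      using subtopology_restrict[of "SL_block_topology U" ?D] by (simp add: Collect_conj_eq)
    from o[unfolded this] openin_flag_domain_SL_block[OF U] show ?thesis
      by (rule openin_trans_full)
  qed
  then have "openin flag_topology ?W"
    unfolding openin_flag_topology_iff using sub by auto
  then show "openin (subtopology flag_topology flag_domain)
      {F \<in> topspace (subtopology flag_topology flag_domain). graph_map F \<in> V}"
    unfolding tops by (simp add: openin_open_subtopology openin_flag_domain)
qed

lemma homeomorphic_map_graph_map:
  "homeomorphic_map (subtopology flag_topology flag_domain)
    (subtopology finitary_topology matrix_domain) graph_map"
proof -
  have "continuous_map (subtopology finitary_topology matrix_domain) flag_topology graph_flag"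
    by (rule continuous_map_from_subtopology[OF continuous_map_graph_flag])
  then have "homeomorphic_maps (subtopology flag_topology flag_domain)
      (subtopology finitary_topology matrix_domain) graph_map graph_flag"
    using continuous_map_graph_map
    by (auto simp: homeomorphic_maps_def continuous_map_in_subtopology flag_domain_eq)
  then show ?thesis using homeomorphic_maps_map by blast
qed

text \<open>\<open>graph_flag\<close> is continuous on all finitary maps, contractive or not, and it
  pulls the open flag domain back to the strict contractions.\<close>

lemma openin_matrix_domain: "openin finitary_topology matrix_domain"
proof -
  have "matrix_domain = {X \<in> topspace finitary_topology. graph_flag X \<in> flag_domain}"
    by (auto simp: topspace_finitary_topology graph_flag_in_flag_domain_iff matrix_domain_iff
        simp del: not_less)
  then show ?thesis
    using openin_continuous_map_preimage[OF continuous_map_graph_flag openin_flag_domain] by metis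
qed

lemma connectedin_matrix_domain:
  "connectedin finitary_topology (matrix_domain :: ('q hminus \<Rightarrow> hplus) set)"
proof -
  define h where "h = (\<lambda>(X :: 'q hminus \<Rightarrow> hplus) t y. X y *\<^sub>H of_real t)"
  have seg: "connectedin finitary_topology (h X ` {0..1})" "h X ` {0..1} \<subseteq> matrix_domain"
    "X \<in> h X ` {0..1}" "(\<lambda>_. 0) \<in> h X ` {0..1}" if X: "X \<in> matrix_domain" for X
  proof -
    have "finitary X" using X by (simp add: matrix_domain_iff)
    then obtain S T where ST: "finite S" "finite T" "X \<in> finitary_block S T"
      by (rule finitary_imp_finitary_block)
    note lin = hlinear_if_finitary_block[OF ST(3)]
    have entry_h: "entry (h X t) i j = entry X i j * of_real t" for t i j
      by (simp add: entry_def h_def)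
    have "hlinear (h X t)" for t
      by (simp add: hlinear_def h_def hlinear_add[OF lin] hlinear_rscale[OF lin] rscale_add_left
          rscale_rscale of_real_mult_commute_quat)
    then have blk: "h X t \<in> finitary_block S T" for t
      using ST(3) by (auto simp: finitary_block_def entry_h)
    \<comment> \<open>The whole segment stays in one block of \<open>X\<close>, so continuity of the
      path needs checking only entry by entry in that block.\<close>
    have "continuous_map (top_of_set {0..1}) (block_topology S T) (h X)"
    proof (rule continuous_map_into_block_topology)
      show "continuous_map (top_of_set {0..1}) euclidean (\<lambda>t. entry (h X t) i j)" for i j
        by (simp add: entry_h) (intro continuous_intros)
    qed (rule blk)
    then have "continuous_map (top_of_set {0..1}) finitary_topology (h X)"
      by (rule continuous_map_into_finitary_topology[OF ST(1,2)])
    from connectedin_continuous_map_image[OF this, of "{0..1}"]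
    show "connectedin finitary_topology (h X ` {0..1})"
      by (simp add: connectedin_subtopology)
    have "hnorm (h X t y) < hnorm y" if "0 \<le> t" "t \<le> 1" "y \<noteq> 0" for t y
    proof -
      have "hnorm (h X t y) = hnorm (X y) * t" using that by (simp add: h_def hnorm_rscale)
      also have "\<dots> \<le> hnorm (X y)" using that by (simp add: mult_left_le)
      also have "\<dots> < hnorm y" using X that by (simp add: matrix_domain_iff)
      finally show ?thesis .
    qed
    then show "h X ` {0..1} \<subseteq> matrix_domain"
      using finitary_if_finitary_block[OF blk ST(1,2)] by (auto simp: matrix_domain_iff)
    show "X \<in> h X ` {0..1}" by (rule image_eqI[of _ _ 1]) (simp_all add: h_def rscale_one)
    show "(\<lambda>_. 0) \<in> h X ` {0..1}" by (rule image_eqI[of _ _ 0]) (simp_all add: h_def)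
  qed
  have "connectedin finitary_topology (\<Union>X\<in>matrix_domain. h X ` {0..1})"
  proof (rule connectedin_Union)
    have "(\<lambda>_. 0) \<in> (\<Inter>X\<in>matrix_domain. h X ` {0..1})" using seg(4) by (intro INT_I)
    then show "(\<Inter>X\<in>matrix_domain. h X ` {0..1}) \<noteq> {}" by blast
  qed (use seg(1) in blast)
  moreover have "(\<Union>X\<in>matrix_domain. h X ` {0..1}) = matrix_domain"
  proof (rule equalityI)
    show "(\<Union>X\<in>matrix_domain. h X ` {0..1}) \<subseteq> matrix_domain" using seg(2) by (rule UN_least)
    show "matrix_domain \<subseteq> (\<Union>X\<in>matrix_domain. h X ` {0..1})"
      using seg(3) by (intro subsetI UN_I)
  qed
  ultimately show ?thesis by simp
qed

text \<open>Being a domain is rendered as open and connected, boundedness as one operator norm bound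
  for all \<open>X\<close>. In the action formula \<open>bij Q\<close> makes \<open>inv Q\<close> a
  genuine inverse instead of an arbitrary choice of preimages.\<close>

theorem proposition6p2p5:
  shows
    \<comment> \<open>to a flag corresponds the map \<open>proj_minus x \<mapsto> proj_plus x\<close>\<close>
    "(\<forall>(E0, E1, E2) \<in> (flag_domain :: 'q::countable hflag set). bij_betw proj_minus E1 UNIV \<and>
        (\<forall>x\<in>E1. graph_map (E0, E1, E2) (proj_minus x) = proj_plus x)) \<and>
      bij_betw graph_map (flag_domain :: 'q hflag set) (matrix_domain :: ('q hminus \<Rightarrow> hplus) set) \<and>
      openin flag_topology (flag_domain :: 'q hflag set) \<and>
      homeomorphic_map
        (subtopology flag_topology (flag_domain :: 'q hflag set))
        (subtopology finitary_topology (matrix_domain :: ('q hminus \<Rightarrow> hplus) set)) graph_map \<and>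
      openin finitary_topology (matrix_domain :: ('q hminus \<Rightarrow> hplus) set) \<and>
      connectedin finitary_topology (matrix_domain :: ('q hminus \<Rightarrow> hplus) set) \<and>
      (\<exists>c. \<forall>X \<in> (matrix_domain :: ('q hminus \<Rightarrow> hplus) set). \<forall>y. hnorm (X y) \<le> c * hnorm y) \<and>
      (\<forall>g \<in> Sp_inf. \<forall>F \<in> (flag_domain :: 'q hflag set).
        flag_act g F \<in> flag_domain \<and>
        (let X = graph_map F;
             N = (\<lambda>y. block_A g (X y) + block_B g y);
             Q = (\<lambda>y. block_C g (X y) + block_D g y)
         in bij Q \<and> graph_map (flag_act g F) = N \<circ> inv Q))"
proof (intro conjI)
  have "bij_betw snd (range (\<lambda>y. (X y, y))) UNIV \<and>
      (\<forall>x\<in>range (\<lambda>y. (X y, y)). graph_map (graph_flag X) (snd x) = fst x)"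
    for X :: "'q hminus \<Rightarrow> hplus"
    by (auto simp: bij_betw_def inj_on_def image_image)
  then show "\<forall>(E0, E1, E2) \<in> (flag_domain :: 'q hflag set). bij_betw proj_minus E1 UNIV \<and>
        (\<forall>x\<in>E1. graph_map (E0, E1, E2) (proj_minus x) = proj_plus x)"
    unfolding flag_domain_eq by (auto simp: graph_flag_def)
  \<comment> \<open>The constant is 1; \<open>y = 0\<close> is split off because the contraction
    inequality is strict and speaks of nonzero vectors only.\<close>
  have "hnorm (X y) \<le> 1 * hnorm y" if "X \<in> matrix_domain" for X :: "'q hminus \<Rightarrow> hplus" and y
    using that by (cases "y = 0") (auto simp: matrix_domain_iff finitary_def hlinear_0 less_imp_le)
  then show "\<exists>c. \<forall>X \<in> (matrix_domain :: ('q hminus \<Rightarrow> hplus) set). \<forall>y. hnorm (X y) \<le> c * hnorm y"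
    by blast
  show "\<forall>g \<in> Sp_inf. \<forall>F \<in> (flag_domain :: 'q hflag set).
        flag_act g F \<in> flag_domain \<and>
        (let X = graph_map F;
             N = (\<lambda>y. block_A g (X y) + block_B g y);
             Q = (\<lambda>y. block_C g (X y) + block_D g y)
         in bij Q \<and> graph_map (flag_act g F) = N \<circ> inv Q)"
    unfolding flag_domain_eq[symmetric] Let_def
    by (auto simp: flag_domain_eq graph_map_flag_act[unfolded flag_domain_eq])
qed (rule bij_betw_graph_map openin_flag_domain homeomorphic_map_graph_map openin_matrix_domain
    connectedin_matrix_domain)+

end
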